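(* Let $X$ be a complex Banach space and let $(T(t))_{t\geq 0}$ be a $C_0$ semigroup on $X$ with infinitesimal generator $A$. Suppose that there exists $t_0>0$ such that $AT(t_0)$ is bounded. Then for every $t>0$, $$\sigma_{uf}(T(t))\setminus\{0\}=\{e^{\lambda t} : \lambda\in\sigma_{uf}(A)\}.$$ If moreover $X$ is reflexive, then for every $t>0$, $$\sigma_{lf}(T(t))\setminus\{0\}=\{e^{\lambda t} : \lambda\in\sigma_{lf}(A)\},$$ $$\sigma_{e}(T(t))\setminus\{0\}=\{e^{\lambda t} : \lambda\in\sigma_{e}(A)\}.$$
   Context: "$AT(t_0)$ is bounded" means that $T(t_0)X\subseteq D(A)$ and $AT(t_0)$ is a bounded linear operator on $X$. For a closed linear operator $S$ on $X$ with domain $D(S)$, $N(S)$ is its null space and $R(S)$ its range. $S$ is upper semi-Fredholm if $\dim N(S)<\infty$ and $R(S)$ is closed; lower semi-Fredholm if $\operatorname{codim} R(S)<\infty$; Fredholm if it is both upper and lower semi-Fredholm. The spectra are $\sigma_{uf}(S)=\{\lambda\in\mathbb{C}: S-\lambda I \text{ is not upper semi-Fredholm}\}$, $\sigma_{lf}(S)=\{\lambda\in\mathbb{C}: S-\lambda I \text{ is not lower semi-Fredholm}\}$, $\sigma_{e}(S)=\{\lambda\in\mathbb{C}: S-\lambda I \text{ is not Fredholm}\}$. *)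

theory Defs
  imports "HOL-Analysis.Analysis"
begin

class scaleC =
  fixes scaleC :: "complex \<Rightarrow> 'a \<Rightarrow> 'a" (infixr \<open>*\<^sub>C\<close> 75)

class complex_normed_vector = real_normed_vector + scaleC +
  assumes scaleC_add_right: "c *\<^sub>C (x + y) = c *\<^sub>C x + c *\<^sub>C y"
    and scaleC_add_left: "(c + d) *\<^sub>C x = c *\<^sub>C x + d *\<^sub>C x"
    and scaleC_scaleC: "c *\<^sub>C d *\<^sub>C x = (c * d) *\<^sub>C x"
    and scaleC_of_real: "complex_of_real r *\<^sub>C x = r *\<^sub>R x"
    and norm_scaleC: "norm (c *\<^sub>C x) = cmod c * norm x"

class complex_banach = complex_normed_vector + banach

instantiation complex :: complex_banach
begin

definition scaleC_complex_def: "c *\<^sub>C z = c * (z :: complex)"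

instance
  by standard
    (simp_all add: scaleC_complex_def algebra_simps norm_mult scaleR_conv_of_real)

end

global_interpretation complex_vector:
  vector_space "scaleC :: complex \<Rightarrow> 'a \<Rightarrow> 'a::complex_normed_vector"
proof
  show "1 *\<^sub>C x = x" for x :: 'a
    using scaleC_of_real[of 1 x] by simp
qed (simp_all add: scaleC_add_right scaleC_add_left scaleC_scaleC)

definition bounded_clinear ::
    "('a::complex_normed_vector \<Rightarrow> 'b::complex_normed_vector) \<Rightarrow> bool" where
  "bounded_clinear f \<longleftrightarrow> bounded_linear f \<and> (\<forall>c x. f (c *\<^sub>C x) = c *\<^sub>C f x)"

definition finite_cdim :: "'a::complex_normed_vector set \<Rightarrow> bool" where
  "finite_cdim V \<longleftrightarrow> (\<exists>B. finite B \<and> V \<subseteq> complex_vector.span B)"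

text \<open>The cosets of finitely many vectors span the quotient of the space by \<open>V\<close>.\<close>

definition finite_ccodim :: "'a::complex_normed_vector set \<Rightarrow> bool" where
  "finite_ccodim V \<longleftrightarrow> (\<exists>B. finite B \<and> (\<forall>x. \<exists>b \<in> complex_vector.span B. x - b \<in> V))"

text \<open>
  A possibly unbounded operator is given by its domain \<open>D\<close> and a total function \<open>S\<close> whose
  values outside \<open>D\<close> are irrelevant. The notions below are meant for closed linear operators;
  closedness is not part of the predicates. The operators they are applied to here, generators
  of \<open>C\<^sub>0\<close> semigroups and everywhere defined bounded operators, are always closed.
\<close>

definition upper_semi_fredholm ::
    "'a::complex_normed_vector set \<Rightarrow> ('a \<Rightarrow> 'a) \<Rightarrow> bool" where
  "upper_semi_fredholm D S \<longleftrightarrow> finite_cdim {x \<in> D. S x = 0} \<and> closed (S ` D)"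

definition lower_semi_fredholm ::
    "'a::complex_normed_vector set \<Rightarrow> ('a \<Rightarrow> 'a) \<Rightarrow> bool" where
  "lower_semi_fredholm D S \<longleftrightarrow> finite_ccodim (S ` D)"

definition fredholm :: "'a::complex_normed_vector set \<Rightarrow> ('a \<Rightarrow> 'a) \<Rightarrow> bool" where
  "fredholm D S \<longleftrightarrow> upper_semi_fredholm D S \<and> lower_semi_fredholm D S"

definition spectrum_uf :: "'a::complex_normed_vector set \<Rightarrow> ('a \<Rightarrow> 'a) \<Rightarrow> complex set" where
  "spectrum_uf D S = {\<mu>. \<not> upper_semi_fredholm D (\<lambda>x. S x - \<mu> *\<^sub>C x)}"

definition spectrum_lf :: "'a::complex_normed_vector set \<Rightarrow> ('a \<Rightarrow> 'a) \<Rightarrow> complex set" where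
  "spectrum_lf D S = {\<mu>. \<not> lower_semi_fredholm D (\<lambda>x. S x - \<mu> *\<^sub>C x)}"

definition spectrum_e :: "'a::complex_normed_vector set \<Rightarrow> ('a \<Rightarrow> 'a) \<Rightarrow> complex set" where
  "spectrum_e D S = {\<mu>. \<not> fredholm D (\<lambda>x. S x - \<mu> *\<^sub>C x)}"

text \<open>Only the values of \<open>T\<close> at nonnegative times matter.\<close>

definition C0_semigroup :: "(real \<Rightarrow> 'a::complex_banach \<Rightarrow> 'a) \<Rightarrow> bool" where
  "C0_semigroup T \<longleftrightarrow>
     (\<forall>t\<ge>0. bounded_clinear (T t)) \<and>
     (\<forall>x. T 0 x = x) \<and>
     (\<forall>s\<ge>0. \<forall>t\<ge>0. \<forall>x. T (s + t) x = T s (T t x)) \<and>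
     (\<forall>x. ((\<lambda>t. T t x) \<longlongrightarrow> x) (at_right 0))"

definition generator_domain :: "(real \<Rightarrow> 'a::complex_banach \<Rightarrow> 'a) \<Rightarrow> 'a set" where
  "generator_domain T = {x. \<exists>y. ((\<lambda>h. (T h x - x) /\<^sub>R h) \<longlongrightarrow> y) (at_right 0)}"

definition generator :: "(real \<Rightarrow> 'a::complex_banach \<Rightarrow> 'a) \<Rightarrow> 'a \<Rightarrow> 'a" where
  "generator T x = Lim (at_right 0) (\<lambda>h. (T h x - x) /\<^sub>R h)"

definition generator_comp_bounded :: "(real \<Rightarrow> 'a::complex_banach \<Rightarrow> 'a) \<Rightarrow> real \<Rightarrow> bool" where
  "generator_comp_bounded T t \<longleftrightarrow>
     range (T t) \<subseteq> generator_domain T \<and> bounded_clinear (\<lambda>x. generator T (T t x))"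

definition cdual :: "('a::complex_normed_vector \<Rightarrow> complex) set" where
  "cdual = {f. bounded_clinear f}"

text \<open>
  Elements of the bidual are represented by functions on all of \<open>'a \<Rightarrow> complex\<close>, whose values
  outside \<^const>\<open>cdual\<close> are irrelevant; \<^const>\<open>onorm\<close> is the norm of the dual space.
\<close>

definition cbidual_functional ::
    "(('a::complex_normed_vector \<Rightarrow> complex) \<Rightarrow> complex) \<Rightarrow> bool" where
  "cbidual_functional \<Phi> \<longleftrightarrow>
     (\<forall>f\<in>cdual. \<forall>g\<in>cdual. \<Phi> (\<lambda>x. f x + g x) = \<Phi> f + \<Phi> g) \<and>
     (\<forall>c. \<forall>f\<in>cdual. \<Phi> (\<lambda>x. c * f x) = c * \<Phi> f) \<and>
     (\<exists>K. \<forall>f\<in>cdual. cmod (\<Phi> f) \<le> K * onorm f)"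

definition reflexive_space :: "'a::complex_banach itself \<Rightarrow> bool" where
  "reflexive_space _ \<longleftrightarrow>
     (\<forall>\<Phi> :: ('a \<Rightarrow> complex) \<Rightarrow> complex. cbidual_functional \<Phi> \<longrightarrow>
        (\<exists>x. \<forall>f\<in>cdual. \<Phi> f = f x))"

end

theory Submission imports Defs begin

text \<open>
  Put \<open>U s = exp (- l s) T s\<close>, a semigroup with generator \<open>A - l\<close>, and
  \<open>V\<^sub>l x = \<integral>\<^sub>0\<^sup>t U s x ds\<close>. Then \<open>U t - 1\<close> equals \<open>(A - l) V\<^sub>l\<close> everywhere and \<open>V\<^sub>l (A - l)\<close> on the
  domain. Hence the range of \<open>U t - 1\<close> lies in that of \<open>A - l\<close>, and the null spaces are included the
  other way. If \<open>U t - 1\<close> has closed range, so does \<open>A - l\<close>: for \<open>y\<close> in the closure of its range,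
  \<open>V\<^sub>l y = (U t - 1) w\<close>, where \<open>w\<close> lies in the domain because \<open>T\<close> eventually maps into it, so
  \<open>y - (A - l) w\<close> is in the null space of \<open>V\<^sub>l\<close>, which is contained in the range of \<open>A - l\<close>.

  For the converse fix \<open>l\<close>, let \<open>l\<^sub>j\<close> run over the solutions of \<open>exp (l\<^sub>j t) = exp (l t)\<close>, and average
  \<open>U\<close> against a trigonometric approximate identity concentrated at \<open>t / 2\<close>. The average is a finite
  combination of the \<open>V\<close> with index \<open>l\<^sub>j\<close>, and eventual norm continuity gives
  \<open>1 - R = (U t - 1) G + \<Sum>\<^sub>j W\<^sub>j V\<^sub>j\<close> with commuting bounded operators and \<open>\<parallel>R\<parallel> < 1\<close>. This identity
  transfers closed range, finite nullity and finite codimension from all \<open>A - l\<^sub>j\<close> to \<open>U t - 1\<close>.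
\<close>

section \<open>Bounded complex-linear maps\<close>

lemma bounded_linear_scaleC: "bounded_linear (\<lambda>x::'a::complex_normed_vector. c *\<^sub>C x)"
proof (rule bounded_linear_intro[where K="cmod c"])
  show "c *\<^sub>C (r *\<^sub>R x) = r *\<^sub>R (c *\<^sub>C x)" for r and x :: 'a
    by (simp only: scaleC_of_real[symmetric] scaleC_scaleC mult.commute)
qed (simp_all add: scaleC_add_right norm_scaleC mult.commute)

lemma bounded_bilinear_scaleC:
  "bounded_bilinear (scaleC :: complex \<Rightarrow> 'a \<Rightarrow> 'a::complex_normed_vector)"
proof
  show "(r *\<^sub>R c) *\<^sub>C x = r *\<^sub>R (c *\<^sub>C x)" for r c and x :: 'a
    by (simp only: scaleR_conv_of_real scaleC_scaleC[symmetric] scaleC_of_real[of _ "c *\<^sub>C x"])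
  show "c *\<^sub>C (r *\<^sub>R x) = r *\<^sub>R (c *\<^sub>C x)" for r c and x :: 'a
    by (simp only: scaleC_of_real[symmetric] scaleC_scaleC mult.commute)
  show "\<exists>K. \<forall>c. \<forall>x::'a. norm (c *\<^sub>C x) \<le> norm c * norm x * K"
    by (rule exI[of _ 1]) (simp add: norm_scaleC)
qed (simp_all add: scaleC_add_right scaleC_add_left)

lemmas tendsto_scaleC [tendsto_intros] = bounded_bilinear.tendsto[OF bounded_bilinear_scaleC]
lemmas scaleC_diff_right = bounded_bilinear.diff_right[OF bounded_bilinear_scaleC]
lemmas scaleC_diff_left = bounded_bilinear.diff_left[OF bounded_bilinear_scaleC]

lemma bounded_clinear_bounded_linear: "bounded_clinear f \<Longrightarrow> bounded_linear f"
  by (simp add: bounded_clinear_def)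

lemma bounded_clinear_simps:
  assumes "bounded_clinear f"
  shows "f (x + y) = f x + f y" "f (x - y) = f x - f y" "f 0 = 0" "f (- x) = - f x"
    "f (c *\<^sub>C x) = c *\<^sub>C f x" "f (r *\<^sub>R x) = r *\<^sub>R f x"
proof -
  interpret bounded_linear f
    using assms by (simp add: bounded_clinear_def)
  show "f (x + y) = f x + f y" "f (x - y) = f x - f y" "f 0 = 0" "f (- x) = - f x"
    "f (c *\<^sub>C x) = c *\<^sub>C f x" "f (r *\<^sub>R x) = r *\<^sub>R f x"
    using assms by (simp_all add: add diff zero neg scaleR bounded_clinear_def)
qed

lemma bounded_clinear_sum:
  "bounded_clinear f \<Longrightarrow> f (\<Sum>i\<in>I. g i) = (\<Sum>i\<in>I. f (g i))"
  by (simp add: bounded_clinear_def bounded_linear.linear linear_sum)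

lemma bounded_clinear_compose:
  "bounded_clinear f \<Longrightarrow> bounded_clinear g \<Longrightarrow> bounded_clinear (\<lambda>x. f (g x))"
  by (simp add: bounded_clinear_def bounded_linear_compose)

lemma bounded_clinear_ident: "bounded_clinear (\<lambda>x. x)"
  by (simp add: bounded_clinear_def)

lemma bounded_clinear_zero: "bounded_clinear (\<lambda>x. 0)"
  by (simp add: bounded_clinear_def bounded_linear_zero)

lemma bounded_clinear_add:
  "bounded_clinear f \<Longrightarrow> bounded_clinear g \<Longrightarrow> bounded_clinear (\<lambda>x. f x + g x)"
  by (simp add: bounded_clinear_def bounded_linear_add scaleC_add_right)

lemma bounded_clinear_sub:
  "bounded_clinear f \<Longrightarrow> bounded_clinear g \<Longrightarrow> bounded_clinear (\<lambda>x. f x - g x)"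
  by (simp add: bounded_clinear_def bounded_linear_sub scaleC_diff_right)

lemma bounded_clinear_scaleC:
  "bounded_clinear f \<Longrightarrow> bounded_clinear (\<lambda>x. c *\<^sub>C f x)"
  by (simp add: bounded_clinear_def bounded_linear_compose[OF bounded_linear_scaleC] scaleC_scaleC
      mult.commute)

lemma bounded_clinear_sum_fun:
  "(\<And>i. i \<in> I \<Longrightarrow> bounded_clinear (f i)) \<Longrightarrow> bounded_clinear (\<lambda>x. \<Sum>i\<in>I. f i x)"
  by (induction I rule: infinite_finite_induct)
    (simp_all add: bounded_clinear_zero bounded_clinear_add)

lemma bounded_clinear_span:
  assumes "bounded_clinear f" "x \<in> complex_vector.span B"
  shows "f x \<in> complex_vector.span (f ` B)"
  using assms(2)
proof (induction rule: complex_vector.span_induct_alt)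
  case base
  then show ?case
    by (simp add: bounded_clinear_simps[OF assms(1)] complex_vector.span_zero)
next
  case (step c x y)
  then show ?case
    by (simp add: bounded_clinear_simps[OF assms(1)] complex_vector.span_add
        complex_vector.span_scale complex_vector.span_base)
qed

section \<open>Strongly continuous semigroups\<close>

definition orbit_integral :: "(real \<Rightarrow> 'a::complex_banach \<Rightarrow> 'a) \<Rightarrow> real \<Rightarrow> 'a \<Rightarrow> 'a" where
  "orbit_integral T t x = integral {0..t} (\<lambda>s. T s x)"

locale C0 =
  fixes T :: "real \<Rightarrow> 'a::complex_banach \<Rightarrow> 'a"
  assumes C0: "C0_semigroup T"
begin

abbreviation "D \<equiv> generator_domain T"
abbreviation "A \<equiv> generator T"
abbreviation "V \<equiv> orbit_integral T"

section \<open>Semigroup law, local boundedness and continuity of orbits\<close>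

lemma bounded_clinear_T: "t \<ge> 0 \<Longrightarrow> bounded_clinear (T t)"
  and T_0: "T 0 x = x"
  and T_add: "s \<ge> 0 \<Longrightarrow> t \<ge> 0 \<Longrightarrow> T (s + t) x = T s (T t x)"
  and T_tendsto_0: "((\<lambda>t. T t x) \<longlongrightarrow> x) (at_right 0)"
  using C0 by (auto simp: C0_semigroup_def)

lemmas T_simps = bounded_clinear_simps[OF bounded_clinear_T]

lemma T_commute: "s \<ge> 0 \<Longrightarrow> t \<ge> 0 \<Longrightarrow> T s (T t x) = T t (T s x)"
  by (metis T_add add.commute)

text \<open>A Baire category argument as in the uniform boundedness principle: convergence at 0
  bounds each orbit near 0, so the closed sets \<open>E n\<close> cover the space and one of them
  contains a ball.\<close>

lemma bounded_near_0: "\<exists>\<delta>>0. \<exists>M. \<forall>s\<in>{0..\<delta>}. \<forall>x. norm (T s x) \<le> M * norm x"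
proof -
  \<comment> \<open>A single index governs both the length of the time interval and the bound, so
    countably many sets suffice.\<close>
  define E where "E n = {x. \<forall>s\<in>{0<..1 / real (Suc n)}. norm (T s x) \<le> real n}" for n :: nat
  have "closed (E n)" for n
  proof -
    have "E n = (\<Inter>s\<in>{0<..1 / real (Suc n)}. {x. norm (T s x) \<le> real n})"
      by (auto simp: E_def)
    moreover have "closed {x. norm (T s x) \<le> real n}" if "s \<in> {0<..1 / real (Suc n)}" for s
      using that
      by (intro closed_Collect_le continuous_intros linear_continuous_on
          bounded_clinear_bounded_linear bounded_clinear_T) auto
    ultimately show ?thesis by auto
  qed
  moreover have "(\<Union>n. E n) = UNIV"
  proof (intro equalityI subsetI UNIV_I)
    fix x
    have "eventually (\<lambda>s. dist (T s x) x < 1) (at_right 0)"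
      using T_tendsto_0[of x] by (simp add: tendsto_iff)
    then obtain d where d: "d > 0" "\<And>s. 0 < s \<Longrightarrow> s < d \<Longrightarrow> dist (T s x) x < 1"
      by (auto simp: eventually_at_right_field)
    obtain n1 where n1: "1 / real (Suc n1) < d"
      using nat_approx_posE[OF d(1)] by blast
    obtain n2 :: nat where n2: "norm x + 1 \<le> real n2"
      using real_arch_simple by blast
    define n where "n = max n1 n2"
    have "norm (T s x) \<le> real n" if s: "s \<in> {0<..1 / real (Suc n)}" for s
    proof -
      have "1 / real (Suc n) \<le> 1 / real (Suc n1)"
        by (intro divide_left_mono) (auto simp: n_def)
      then have "dist (T s x) x < 1"
        using s n1 d(2)[of s] by auto
      then have "norm (T s x) \<le> norm x + 1"
        using norm_triangle_ineq2[of "T s x" x] by (simp add: dist_norm)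
      also have "\<dots> \<le> real n" using n2 by (simp add: n_def)
      finally show ?thesis .
    qed
    then have "x \<in> E n" by (simp add: E_def)
    then show "x \<in> (\<Union>n. E n)" by blast
  qed
  ultimately have "\<exists>n. interior (E n) \<noteq> {}"
  proof -
    assume cl: "\<And>n. closed (E n)" and un: "(\<Union>n. E n) = UNIV"
    show ?thesis
    proof (rule ccontr)
      assume "\<not> ?thesis"
      then have "euclidean interior_of \<Union>(range E) = {}"
        using cl by (intro Baire_category_alt) (auto simp: completely_metrizable_space_euclidean)
      then show False using un by simp
    qed
  qed
  then obtain n x0 where "x0 \<in> interior (E n)" by blast
  then obtain \<rho> where \<rho>: "\<rho> > 0" "cball x0 \<rho> \<subseteq> E n"
    by (metis mem_interior_cball)
  have bd: "norm (T s x) \<le> 2 * real n / \<rho> * norm x" if s: "s \<in> {0<..1 / real (Suc n)}" for s x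
  proof (cases "x = 0")
    case True
    then show ?thesis using s by (simp add: T_simps)
  next
    case False
    \<comment> \<open>\<open>y\<close> is \<open>x\<close> rescaled to norm \<open>\<rho>\<close>,
      so \<open>x0\<close> and \<open>x0 + y\<close> both lie in the ball; subtracting two values of
      norm at most \<open>n\<close> gives the factor 2.\<close>
    define y where "y = (\<rho> / norm x) *\<^sub>R x"
    have "norm y = \<rho>" using False \<rho> by (simp add: y_def)
    then have "x0 + y \<in> E n" "x0 \<in> E n"
      using \<rho> by (auto simp: dist_norm subset_iff)
    then have "norm (T s (x0 + y)) \<le> real n" "norm (T s x0) \<le> real n"
      using s by (auto simp: E_def)
    moreover have "T s y = T s (x0 + y) - T s x0"
      using s by (simp add: T_simps)
    ultimately have "norm (T s y) \<le> 2 * real n"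
      using norm_triangle_ineq4[of "T s (x0 + y)" "T s x0"] by simp
    moreover have "norm (T s y) = \<rho> / norm x * norm (T s x)"
      using s \<rho> by (simp add: y_def T_simps)
    ultimately show ?thesis using False \<rho> by (simp add: field_simps)
  qed
  \<comment> \<open>The maximum with 1 covers time 0, which \<open>E n\<close> leaves out.\<close>
  have "norm (T s x) \<le> max 1 (2 * real n / \<rho>) * norm x" if s: "s \<in> {0..1 / real (Suc n)}" for s x
  proof (cases "s = 0")
    case True
    then show ?thesis
      using mult_right_mono[of 1 "max 1 (2 * real n / \<rho>)" "norm x"] by (simp add: T_0)
  next
    case False
    then have "norm (T s x) \<le> 2 * real n / \<rho> * norm x"
      using bd[of s] s by simp
    also have "\<dots> \<le> max 1 (2 * real n / \<rho>) * norm x"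
      by (intro mult_right_mono) auto
    finally show ?thesis .
  qed
  then show ?thesis
    by (intro exI[of _ "1 / real (Suc n)"] conjI exI[of _ "max 1 (2 * real n / \<rho>)"]) auto
qed

text \<open>The semigroup law cuts a time interval into pieces of length at most
  \<open>\<delta>\<close>, each costing one factor \<open>M\<close>.\<close>

lemma locally_bounded: "\<exists>M\<ge>1. \<forall>s\<in>{0..t}. \<forall>x. norm (T s x) \<le> M * norm x"
proof -
  obtain \<delta> M0 where \<delta>: "\<delta> > 0" and M0: "\<And>s x. s \<in> {0..\<delta>} \<Longrightarrow> norm (T s x) \<le> M0 * norm x"
    using bounded_near_0 by blast
  define M where "M = max 1 M0"
  have M: "norm (T s x) \<le> M * norm x" if "s \<in> {0..\<delta>}" for s x
    using M0[OF that, of x] mult_right_mono[of M0 M "norm x"] by (simp add: M_def)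
  have M1: "M \<ge> 1" by (simp add: M_def)
  have *: "norm (T s x) \<le> M ^ Suc n * norm x" if "s \<in> {0..real n * \<delta>}" for n s x
    using that
  proof (induction n arbitrary: s)
    case 0
    then show ?case using M[of s x] \<delta> by simp
  next
    case (Suc n)
    show ?case
    proof (cases "s \<le> \<delta>")
      case True
      have "norm (T s x) \<le> M * norm x" using M True Suc.prems by simp
      also have "\<dots> \<le> M ^ Suc (Suc n) * norm x"
        using M1 by (intro mult_right_mono self_le_power) auto
      finally show ?thesis .
    next
      case False
      then have "T s x = T \<delta> (T (s - \<delta>) x)"
        using T_add[of \<delta> "s - \<delta>" x] \<delta> by simp
      then have "norm (T s x) \<le> M * norm (T (s - \<delta>) x)" using M \<delta> by simp
      also have "\<dots> \<le> M * (M ^ Suc n * norm x)"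
        using Suc.IH[of "s - \<delta>"] Suc.prems False M1 by (intro mult_left_mono) (auto simp: algebra_simps)
      finally show ?thesis by simp
    qed
  qed
  obtain n :: nat where "t / \<delta> \<le> real n" using real_arch_simple by blast
  then have "t \<le> real n * \<delta>" using \<delta> by (simp add: field_simps)
  then have "\<forall>s\<in>{0..t}. \<forall>x. norm (T s x) \<le> M ^ Suc n * norm x"
    using *[of _ n] by auto
  moreover have "M ^ Suc n \<ge> 1" using M1 by (rule one_le_power)
  ultimately show ?thesis by blast
qed

text \<open>The smaller of two times is factored out,
  \<open>T b x - T a x = T a (T (b - a) x - x)\<close>, and the bound on \<open>T a\<close> is
  uniform over \<open>{0..s + 1}\<close>. Convergence at 0 therefore yields continuity from both
  sides.\<close>

lemma continuous_orbit: "continuous_on {0..} (\<lambda>s. T s x)"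
  unfolding continuous_on_iff
proof (intro ballI allI impI)
  fix s e :: real assume s: "s \<in> {0..}" and e: "e > 0"
  obtain M where M: "M \<ge> 1" "\<And>r x. r \<in> {0..s + 1} \<Longrightarrow> norm (T r x) \<le> M * norm x"
    using locally_bounded by blast
  have "eventually (\<lambda>h. dist (T h x) x < e / M) (at_right 0)"
    using T_tendsto_0[of x] e M by (simp add: tendsto_iff)
  then obtain d where d: "d > 0" "\<And>h. 0 < h \<Longrightarrow> h < d \<Longrightarrow> dist (T h x) x < e / M"
    by (auto simp: eventually_at_right_field)
  have *: "dist (T a x) (T b x) < e" if "0 \<le> a" "a \<le> b" "b \<le> s + 1" "b - a < d" for a b
  proof (cases "a = b")
    case False
    have "T b x = T a (T (b - a) x)" using T_add[of a "b - a" x] that by simp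
    then have "T b x - T a x = T a (T (b - a) x - x)" using that by (simp add: T_simps)
    then have "norm (T b x - T a x) \<le> M * norm (T (b - a) x - x)"
      using M(2)[of a] that by simp
    also have "\<dots> < M * (e / M)"
      using d(2)[of "b - a"] that False M(1) by (intro mult_strict_left_mono) (auto simp: dist_norm)
    finally show ?thesis using M(1) by (simp add: dist_norm norm_minus_commute)
  qed (use e in simp)
  show "\<exists>d>0. \<forall>x'\<in>{0..}. dist x' s < d \<longrightarrow> dist (T x' x) (T s x) < e"
  proof (intro exI[of _ "min d 1"] conjI ballI impI)
    fix r :: real assume "r \<in> {0..}" "dist r s < min d 1"
    then show "dist (T r x) (T s x) < e"
      using *[of r s] *[of s r] s by (cases "r \<le> s") (auto simp: dist_real_def dist_commute)
  qed (use d in auto)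
qed

section \<open>Integrals of orbits\<close>

lemma integrable_orbit: "0 \<le> a \<Longrightarrow> (\<lambda>s. T s x) integrable_on {a..b}"
  by (intro integrable_continuous_interval continuous_on_subset[OF continuous_orbit]) auto

lemma bounded_clinear_V: "bounded_clinear (V t)"
proof -
  obtain M where M: "M \<ge> 1" "\<And>s x. s \<in> {0..t} \<Longrightarrow> norm (T s x) \<le> M * norm x"
    using locally_bounded by blast
  have C: "V t (c *\<^sub>C x) = c *\<^sub>C V t x" for c x
  proof -
    have "V t (c *\<^sub>C x) = integral {0..t} ((\<lambda>x. c *\<^sub>C x) \<circ> (\<lambda>s. T s x))"
      unfolding orbit_integral_def by (intro integral_cong) (simp add: T_simps)
    also have "\<dots> = c *\<^sub>C V t x"
      unfolding orbit_integral_def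
      by (intro integral_linear integrable_orbit bounded_linear_scaleC) simp
    finally show ?thesis .
  qed
  have "bounded_linear (V t)"
  proof (rule bounded_linear_intro[where K="M * measure lborel {0..t}"])
    show "V t (x + y) = V t x + V t y" for x y
      unfolding orbit_integral_def
      by (subst integral_add[symmetric]) (auto intro!: integrable_orbit integral_cong simp: T_simps)
    show "V t (r *\<^sub>R x) = r *\<^sub>R V t x" for r x
      using C[of "complex_of_real r" x] by (simp add: scaleC_of_real)
    show "norm (V t x) \<le> norm x * (M * measure lborel {0..t})" for x
    proof -
      have "norm (V t x) \<le> (M * norm x) * measure lborel {0..t}"
        unfolding orbit_integral_def
        using integrable_bound[of "M * norm x" "\<lambda>s. T s x" 0 t] M integrable_orbit[of 0 x t]
        by simp
      then show ?thesis by (simp add: mult_ac)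
    qed
  qed
  then show ?thesis using C by (simp add: bounded_clinear_def)
qed

lemmas V_simps = bounded_clinear_simps[OF bounded_clinear_V]

lemma V_T: "s \<ge> 0 \<Longrightarrow> V t (T s x) = T s (V t x)"
proof -
  assume s: "s \<ge> 0"
  have "V t (T s x) = integral {0..t} (T s \<circ> (\<lambda>r. T r x))"
    unfolding orbit_integral_def by (intro integral_cong) (simp add: T_commute s)
  also have "\<dots> = T s (V t x)"
    unfolding orbit_integral_def
    by (intro integral_linear integrable_orbit bounded_clinear_bounded_linear bounded_clinear_T s)
      simp
  finally show ?thesis .
qed

lemma T_V: "s \<ge> 0 \<Longrightarrow> t \<ge> 0 \<Longrightarrow> T s (V t x) = V (s + t) x - V s x"
proof -
  assume s: "s \<ge> 0" and t: "t \<ge> 0"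
  have "T s (V t x) = integral {0..t} (\<lambda>r. T r (T s x))"
    using V_T[OF s, of t x] by (simp add: orbit_integral_def)
  also have "\<dots> = integral {0..t} ((\<lambda>r. T r x) \<circ> (+) s)"
    by (intro integral_cong) (simp add: T_add[symmetric] s add.commute)
  also have "\<dots> = integral {s..s + t} (\<lambda>r. T r x)"
    by (simp add: integral_shift_Icc_real add.commute)
  also have "\<dots> = V (s + t) x - V s x"
    unfolding orbit_integral_def
    using Henstock_Kurzweil_Integration.integral_combine[of 0 s "s + t" "\<lambda>r. T r x"] s t by (simp add: integrable_orbit algebra_simps)
  finally show ?thesis .
qed

text \<open>Both sides equal \<open>V (s + t) x - V s x - V t x\<close>, which is symmetric in
  \<open>s\<close> and \<open>t\<close>. The exchange turns increments of \<open>V t x\<close> over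
  a small time \<open>h\<close> into values at \<open>V h x\<close>, which are controlled after
  division by \<open>h\<close>.\<close>

lemma V_swap: "s \<ge> 0 \<Longrightarrow> t \<ge> 0 \<Longrightarrow> T s (V t x) - V t x = T t (V s x) - V s x"
  by (simp add: T_V add.commute)

text \<open>The limit is the right derivative of \<open>V u x\<close> at \<open>u = 0\<close>, given
  by the fundamental theorem of calculus.\<close>

lemma V_over_h: "((\<lambda>h. V h x /\<^sub>R h) \<longlongrightarrow> x) (at_right 0)"
proof -
  have "((\<lambda>u. V u x) has_vector_derivative T 0 x) (at 0 within {0..1})"
    unfolding orbit_integral_def
    by (intro integral_has_vector_derivative continuous_on_subset[OF continuous_orbit]) auto
  then have "((\<lambda>u. V u x) has_vector_derivative x) (at 0 within {0..1})"
    by (simp add: T_0)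
  then have "((\<lambda>h. norm (V h x - V 0 x - h *\<^sub>R x) / norm h) \<longlongrightarrow> 0) (at_right 0)"
    by (simp add: has_vector_derivative_def has_derivative_iff_norm at_within_Icc_at_right)
  moreover have "eventually (\<lambda>h. norm (V h x - V 0 x - h *\<^sub>R x) / norm h = norm (V h x /\<^sub>R h - x))
      (at_right (0::real))"
    using eventually_at_right_less[of "0::real"]
  proof eventually_elim
    case (elim h)
    then have "V h x - V 0 x - h *\<^sub>R x = h *\<^sub>R (V h x /\<^sub>R h - x)"
      by (simp add: orbit_integral_def scaleR_diff_right)
    then have "norm (V h x - V 0 x - h *\<^sub>R x) = h * norm (V h x /\<^sub>R h - x)"
      using elim by (simp only: norm_scaleR)
    then show ?case using elim by simp
  qed
  ultimately have "((\<lambda>h. norm (V h x /\<^sub>R h - x)) \<longlongrightarrow> 0) (at_right 0)"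
    by (rule Lim_transform_eventually)
  then show ?thesis
    by (simp only: tendsto_norm_zero_iff LIM_zero_iff)
qed

section \<open>The generator and its interplay with orbit integrals\<close>

lemma generatorI:
  assumes "((\<lambda>h. (T h x - x) /\<^sub>R h) \<longlongrightarrow> y) (at_right 0)"
  shows "x \<in> D" "A x = y"
  using assms tendsto_Lim[OF trivial_limit_at_right_real]
  by (auto simp: generator_domain_def generator_def)

lemma generatorD: "x \<in> D \<Longrightarrow> ((\<lambda>h. (T h x - x) /\<^sub>R h) \<longlongrightarrow> A x) (at_right 0)"
  using generatorI(2) by (auto simp: generator_domain_def)

text \<open>A bounded operator commuting with the semigroup passes through the difference quotient
  and its limit. It is applied to scalar multiples, to \<open>T t\<close> and to
  \<open>V t\<close>.\<close>

lemma generator_intertwine: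
  assumes S: "bounded_clinear S" and comm: "\<And>h. h > 0 \<Longrightarrow> S (T h x) = T h (S x)" and x: "x \<in> D"
  shows "S x \<in> D" "A (S x) = S (A x)"
proof -
  have "((\<lambda>h. S ((T h x - x) /\<^sub>R h)) \<longlongrightarrow> S (A x)) (at_right 0)"
    by (intro bounded_linear.tendsto[OF bounded_clinear_bounded_linear[OF S]] generatorD x)
  moreover have "eventually (\<lambda>h. S ((T h x - x) /\<^sub>R h) = (T h (S x) - S x) /\<^sub>R h) (at_right 0)"
    using eventually_at_right_less[of "0::real"]
    by eventually_elim (simp add: bounded_clinear_simps[OF S] comm)
  ultimately have "((\<lambda>h. (T h (S x) - S x) /\<^sub>R h) \<longlongrightarrow> S (A x)) (at_right 0)"
    by (rule Lim_transform_eventually)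
  then show "S x \<in> D" "A (S x) = S (A x)"
    by (rule generatorI)+
qed

lemma
  assumes "x \<in> D" "y \<in> D"
  shows D_add: "x + y \<in> D" and A_add: "A (x + y) = A x + A y"
proof -
  have "((\<lambda>h. (T h x - x) /\<^sub>R h + (T h y - y) /\<^sub>R h) \<longlongrightarrow> A x + A y) (at_right 0)"
    by (intro tendsto_add generatorD assms)
  moreover have "eventually (\<lambda>h. (T h x - x) /\<^sub>R h + (T h y - y) /\<^sub>R h = (T h (x + y) - (x + y)) /\<^sub>R h)
      (at_right 0)"
    using eventually_at_right_less[of "0::real"]
    by eventually_elim (simp add: T_simps algebra_simps)
  ultimately have "((\<lambda>h. (T h (x + y) - (x + y)) /\<^sub>R h) \<longlongrightarrow> A x + A y) (at_right 0)"
    by (rule Lim_transform_eventually)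
  then show "x + y \<in> D" "A (x + y) = A x + A y"
    by (rule generatorI)+
qed

lemma
  assumes "x \<in> D"
  shows D_scaleC: "c *\<^sub>C x \<in> D" and A_scaleC: "A (c *\<^sub>C x) = c *\<^sub>C A x"
  using generator_intertwine[of "\<lambda>x. c *\<^sub>C x" x] assms
  by (simp_all add: T_simps bounded_clinear_scaleC bounded_clinear_ident)

lemma D_diff: "x \<in> D \<Longrightarrow> y \<in> D \<Longrightarrow> x - y \<in> D"
  using D_add[of x "(-1) *\<^sub>C y"] D_scaleC[of y "-1"] by simp

lemma T_in_D:
  assumes "x \<in> D" "t \<ge> 0"
  shows "T t x \<in> D"
  using generator_intertwine[of "T t" x] assms by (simp_all add: bounded_clinear_T T_commute)

lemma A_V_commute:
  assumes "x \<in> D"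
  shows "A (V t x) = V t (A x)"
  using generator_intertwine[of "V t" x] assms by (simp_all add: bounded_clinear_V V_T)

text \<open>By \<open>V_swap\<close> the difference quotient of \<open>V t x\<close> is
  \<open>T t - 1\<close> applied to \<open>V h x / h\<close>, and the latter tends to
  \<open>x\<close>.\<close>

lemma
  assumes t: "t \<ge> 0"
  shows V_in_D: "V t x \<in> D" and A_V: "A (V t x) = T t x - x"
proof -
  have "bounded_clinear (\<lambda>y. T t y - y)"
    by (intro bounded_clinear_sub bounded_clinear_T bounded_clinear_ident t)
  then have "((\<lambda>h. T t (V h x /\<^sub>R h) - V h x /\<^sub>R h) \<longlongrightarrow> T t x - x) (at_right 0)"
    by (intro bounded_linear.tendsto[of "\<lambda>y. T t y - y"] V_over_h bounded_clinear_bounded_linear)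
  moreover have "eventually (\<lambda>h. T t (V h x /\<^sub>R h) - V h x /\<^sub>R h = (T h (V t x) - V t x) /\<^sub>R h)
      (at_right 0)"
    using eventually_at_right_less[of "0::real"]
    by eventually_elim (simp add: T_simps t V_swap scaleR_diff_right[symmetric])
  ultimately have "((\<lambda>h. (T h (V t x) - V t x) /\<^sub>R h) \<longlongrightarrow> T t x - x) (at_right 0)"
    by (rule Lim_transform_eventually)
  then show "V t x \<in> D" "A (V t x) = T t x - x"
    by (rule generatorI)+
qed

lemma V_A: "x \<in> D \<Longrightarrow> t \<ge> 0 \<Longrightarrow> V t (A x) = T t x - x"
  by (metis A_V A_V_commute)

text \<open>The preimage is \<open>- (1/t) \<integral>\<^sub>0\<^sup>t V s z ds\<close>.\<close>

lemma null_V_subset_range: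
  assumes t: "t > 0" and z: "V t z = 0"
  shows "z \<in> A ` D"
proof -
  have cont: "continuous_on {0..t} (\<lambda>s. V s z)"
    unfolding orbit_integral_def by (intro indefinite_integral_continuous_1 integrable_orbit) simp
  define w where "w = integral {0..t} (\<lambda>s. V s z)"
  \<comment> \<open>\<open>V_swap\<close> under the integral sign moves \<open>h\<close> into the
    argument \<open>V h z\<close>. After division by \<open>h\<close> the right side tends to
    \<open>V t z - t z\<close>, that is, to \<open>- t z\<close>.\<close>
  have *: "T h w - w = V t (V h z) - t *\<^sub>R V h z" if h: "h > 0" for h
  proof -
    have B: "bounded_linear (\<lambda>y. T h y - y)"
      using h by (intro bounded_clinear_bounded_linear bounded_clinear_sub bounded_clinear_T
          bounded_clinear_ident) simp
    have "T h w - w = integral {0..t} ((\<lambda>y. T h y - y) \<circ> (\<lambda>s. V s z))"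
      unfolding w_def
      by (rule integral_linear[OF integrable_continuous_interval[OF cont] B, symmetric])
    also have "\<dots> = integral {0..t} (\<lambda>s. T s (V h z) - V h z)"
      using h by (intro integral_cong) (simp add: V_swap)
    also have "\<dots> = V t (V h z) - t *\<^sub>R V h z"
      unfolding orbit_integral_def[of T t] using t
      by (subst integral_diff) (auto intro!: integrable_orbit)
    finally show ?thesis .
  qed
  have "((\<lambda>h. V t (V h z /\<^sub>R h) - t *\<^sub>R (V h z /\<^sub>R h)) \<longlongrightarrow> V t z - t *\<^sub>R z) (at_right 0)"
    by (intro tendsto_intros V_over_h
        bounded_linear.tendsto[OF bounded_clinear_bounded_linear[OF bounded_clinear_V]])
  moreover have "eventually (\<lambda>h. V t (V h z /\<^sub>R h) - t *\<^sub>R (V h z /\<^sub>R h) = (T h w - w) /\<^sub>R h)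
      (at_right 0)"
    using eventually_at_right_less[of "0::real"]
    by eventually_elim (simp add: * V_simps algebra_simps)
  ultimately have "((\<lambda>h. (T h w - w) /\<^sub>R h) \<longlongrightarrow> V t z - t *\<^sub>R z) (at_right 0)"
    by (rule Lim_transform_eventually)
  then have w: "w \<in> D" "A w = - t *\<^sub>R z"
    using generatorI z by auto
  have "A (complex_of_real (- 1 / t) *\<^sub>C w) = complex_of_real (- 1 / t) *\<^sub>C (- t *\<^sub>R z)"
    by (simp only: A_scaleC[OF w(1)] w(2))
  also have "\<dots> = z"
    using t by (simp only: scaleC_of_real) simp
  finally have "A (complex_of_real (- 1 / t) *\<^sub>C w) = z" .
  then show ?thesis
    using D_scaleC[OF w(1)] by (metis imageI)
qed

end

section \<open>From the semigroup to the generator\<close>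

lemma finite_cdim_mono: "finite_cdim U \<Longrightarrow> W \<subseteq> U \<Longrightarrow> finite_cdim W"
  unfolding finite_cdim_def by (meson order_trans)

lemma finite_ccodim_mono: "finite_ccodim U \<Longrightarrow> U \<subseteq> W \<Longrightarrow> finite_ccodim W"
  unfolding finite_ccodim_def by (meson subsetD)

context C0
begin

lemma null_generator_fixed: "x \<in> D \<Longrightarrow> A x = 0 \<Longrightarrow> t \<ge> 0 \<Longrightarrow> T t x = x"
  using V_A[of x t] by (simp add: V_simps)

lemma eventually_D:
  assumes "range (T r) \<subseteq> D" "0 \<le> r" "r \<le> s"
  shows "T s x \<in> D"
proof -
  have "T s x = T r (T (s - r) x)"
    using T_add[of r "s - r" x] assms by simp
  then show ?thesis using assms by auto
qed

text \<open>Iterating \<open>x = T t x - y\<close> turns \<open>x\<close> into \<open>T (n t) x\<close> modulo the domain, and the former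
  lies in the domain for large \<open>n\<close>.\<close>

lemma D_if_increment_in_D:
  assumes r: "range (T r) \<subseteq> D" "0 \<le> r" and t: "t > 0" and x: "T t x - x \<in> D"
  shows "x \<in> D"
proof -
  have *: "T (real n * t) x - x \<in> D" for n
  proof (induction n)
    case 0
    then show ?case using D_diff[OF x x] by (simp add: T_0)
  next
    case (Suc n)
    have "T (real (Suc n) * t) x = T (real n * t) (T t x)"
      using T_add[of "real n * t" t x] t by (simp add: algebra_simps)
    then have "T (real (Suc n) * t) x - x = T (real n * t) (T t x - x) + (T (real n * t) x - x)"
      using t by (simp add: T_simps)
    also have "\<dots> \<in> D" using Suc t by (intro D_add T_in_D x) auto
    finally show ?case .
  qed
  obtain n :: nat where "r / t \<le> real n" using real_arch_simple by blast
  then have "T (real n * t) x \<in> D"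
    using t by (intro eventually_D[OF r]) (simp add: field_simps)
  from D_diff[OF this *[of n]] show ?thesis by simp
qed

lemma range_subset_generator_range:
  "t \<ge> 0 \<Longrightarrow> range (\<lambda>x. T t x - x) \<subseteq> A ` D"
  by (intro image_subsetI) (simp add: A_V[symmetric] V_in_D)

lemma lower_semi_fredholm_generator:
  assumes "t \<ge> 0" "lower_semi_fredholm UNIV (\<lambda>x. T t x - x)"
  shows "lower_semi_fredholm D A"
  using assms(2) finite_ccodim_mono[OF _ range_subset_generator_range[OF assms(1)]]
  by (simp add: lower_semi_fredholm_def)

lemma upper_semi_fredholm_generator:
  assumes r: "range (T r) \<subseteq> D" "0 \<le> r" and t: "t > 0"
    and usf: "upper_semi_fredholm UNIV (\<lambda>x. T t x - x)"
  shows "upper_semi_fredholm D A"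
proof -
  have "{x \<in> D. A x = 0} \<subseteq> {x \<in> UNIV. T t x - x = 0}"
    using null_generator_fixed t by auto
  then have fin: "finite_cdim {x \<in> D. A x = 0}"
    using usf finite_cdim_mono unfolding upper_semi_fredholm_def by blast
  have "closed (A ` D)"
    unfolding closed_sequential_limits
  proof (intro allI impI)
    fix f y assume "(\<forall>n. f n \<in> A ` D) \<and> f \<longlonglongrightarrow> y"
    then have "\<forall>n. \<exists>x. x \<in> D \<and> f n = A x" and lim: "f \<longlonglongrightarrow> y"
      by blast+
    then obtain x where x: "\<And>n. x n \<in> D" "\<And>n. f n = A (x n)"
      by metis
    \<comment> \<open>Since \<open>V t (A x) = T t x - x\<close> on the domain, \<open>V t\<close>
      carries the approximating sequence into a closed set.\<close>
    have "closed (range (\<lambda>x. T t x - x))"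
      using usf by (simp add: upper_semi_fredholm_def)
    moreover have "V t (f n) \<in> range (\<lambda>x. T t x - x)" for n
      using V_A[OF x(1), of t n] t by (simp add: x(2))
    moreover have "(\<lambda>n. V t (f n)) \<longlonglongrightarrow> V t y"
      by (intro bounded_linear.tendsto[OF bounded_clinear_bounded_linear[OF bounded_clinear_V]] lim)
    ultimately have "V t y \<in> range (\<lambda>x. T t x - x)"
      by (rule closed_sequentially)
    then obtain w where w: "V t y = T t w - w" by (rule rangeE)
    then have "w \<in> D"
      using V_in_D[of t y] t D_if_increment_in_D[OF r t, of w] by simp
    then have "V t (y - A w) = 0"
      using w t by (simp add: V_simps V_A)
    from null_V_subset_range[OF t this] obtain v where v: "v \<in> D" "y - A w = A v" by blast
    then have "y = A (v + w)" using \<open>w \<in> D\<close> by (simp add: A_add algebra_simps)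
    then show "y \<in> A ` D" using D_add v \<open>w \<in> D\<close> by blast
  qed
  with fin show ?thesis by (simp add: upper_semi_fredholm_def)
qed

end

section \<open>Semi-Fredholm operators via commuting factorizations\<close>

text \<open>Banach's fixed point theorem for the contraction sending \<open>u\<close> to
  \<open>y + R u\<close>; it replaces the Neumann series for the inverse of
  \<open>1 - R\<close>.\<close>

lemma neumann_bijective:
  fixes R :: "'a::banach \<Rightarrow> 'a"
  assumes lin: "linear R" and q: "0 \<le> q" "q < 1" "\<And>x. norm (R x) \<le> q * norm x"
  shows "\<exists>!u. u - R u = y"
proof -
  have "\<exists>!u. y + R u = u"
    by (rule banach_fix_type[OF q(1,2)])
      (simp add: dist_norm linear_diff[OF lin, symmetric] q)
  then show ?thesis by (metis add_diff_cancel_right' diff_add_cancel)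
qed

text \<open>\<open>E\<close> plays the role of \<open>T t - \<mu>\<close> and \<open>(D k, B k)\<close> that of \<open>A - \<lambda>\<^sub>k\<close>.\<close>

locale factorization =
  fixes E R G :: "'a::complex_banach \<Rightarrow> 'a"
    and K :: "'i set" and D :: "'i \<Rightarrow> 'a set"
    and B :: "'i \<Rightarrow> 'a \<Rightarrow> 'a" and V W :: "'i \<Rightarrow> 'a \<Rightarrow> 'a" and q :: real
  assumes finite_K: "finite K"
    and E: "bounded_clinear E" and R: "bounded_clinear R" and G: "bounded_clinear G"
    and V: "\<And>k. k \<in> K \<Longrightarrow> bounded_clinear (V k)"
    and W: "\<And>k. k \<in> K \<Longrightarrow> bounded_clinear (W k)"
    and V_D: "\<And>k x. k \<in> K \<Longrightarrow> V k x \<in> D k"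
    and B_V: "\<And>k x. k \<in> K \<Longrightarrow> B k (V k x) = E x"
    and V_B: "\<And>k x. k \<in> K \<Longrightarrow> x \<in> D k \<Longrightarrow> V k (B k x) = E x"
    and E_W: "\<And>k x. k \<in> K \<Longrightarrow> E (W k x) = W k (E x)"
    and E_R: "\<And>x. E (R x) = R (E x)"
    and E_G: "\<And>x. E (G x) = G (E x)"
    and q: "0 \<le> q" "q < 1" "\<And>x. norm (R x) \<le> q * norm x"
    and parametrix: "\<And>x. x - R x = E (G x) + (\<Sum>k\<in>K. W k (V k x))"
begin

lemmas R_bijective = neumann_bijective[OF bounded_linear.linear[OF bounded_clinear_bounded_linear[OF R]] q]

text \<open>Write \<open>x = u - R u\<close> and expand by the parametrix. For each
  \<open>k\<close>, \<open>u\<close> agrees with some \<open>B k w\<close> modulo the span of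
  \<open>F k\<close>, and \<open>V k\<close> maps \<open>B k w\<close> to \<open>E w\<close>. So
  \<open>x\<close> lies in the range of \<open>E\<close> up to the images of the finite sets
  \<open>F k\<close> under \<open>W k\<close> after \<open>V k\<close>.\<close>

lemma lower_semi_fredholm:
  assumes "\<And>k. k \<in> K \<Longrightarrow> lower_semi_fredholm (D k) (B k)"
  shows "lower_semi_fredholm UNIV E"
proof -
  have "\<forall>k\<in>K. \<exists>F. finite F \<and> (\<forall>x. \<exists>b\<in>complex_vector.span F. x - b \<in> B k ` D k)"
    using assms by (simp add: lower_semi_fredholm_def finite_ccodim_def)
  then obtain F where F: "\<And>k. k \<in> K \<Longrightarrow> finite (F k)"
    "\<And>k x. k \<in> K \<Longrightarrow> \<exists>b\<in>complex_vector.span (F k). x - b \<in> B k ` D k"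
    by metis
  define F' where "F' = (\<Union>k\<in>K. (\<lambda>x. W k (V k x)) ` F k)"
  have "\<exists>b\<in>complex_vector.span F'. x - b \<in> range E" for x
  proof -
    obtain u where u: "u - R u = x" using R_bijective by blast
    have "\<forall>k\<in>K. \<exists>b w. b \<in> complex_vector.span (F k) \<and> w \<in> D k \<and> u - b = B k w"
      using F(2) by blast
    then obtain b w where bw: "\<And>k. k \<in> K \<Longrightarrow> b k \<in> complex_vector.span (F k)"
      "\<And>k. k \<in> K \<Longrightarrow> w k \<in> D k" "\<And>k. k \<in> K \<Longrightarrow> u - b k = B k (w k)"
      by metis
    define c where "c = (\<Sum>k\<in>K. W k (V k (b k)))"
    have "W k (V k (b k)) \<in> complex_vector.span F'" if k: "k \<in> K" for k
    proof -
      have "W k (V k (b k)) \<in> complex_vector.span ((\<lambda>x. W k (V k x)) ` F k)"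
        by (rule bounded_clinear_span[OF bounded_clinear_compose[OF W[OF k] V[OF k]] bw(1)[OF k]])
      moreover have "(\<lambda>x. W k (V k x)) ` F k \<subseteq> F'"
        using k by (auto simp: F'_def)
      ultimately show ?thesis
        using complex_vector.span_mono by blast
    qed
    then have "c \<in> complex_vector.span F'"
      unfolding c_def by (rule complex_vector.span_sum)
    moreover have "W k (V k u) - W k (V k (b k)) = E (W k (w k))" if k: "k \<in> K" for k
    proof -
      have "V k (u - b k) = E (w k)"
        using V_B[OF k bw(2)[OF k]] bw(3)[OF k] by simp
      then have "W k (V k (u - b k)) = W k (E (w k))"
        by (rule arg_cong)
      then show ?thesis
        by (simp add: E_W k bounded_clinear_simps[OF V[OF k]] bounded_clinear_simps[OF W[OF k]])
    qed
    then have "x - c = E (G u + (\<Sum>k\<in>K. W k (w k)))"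
      unfolding c_def u[symmetric] parametrix
      by (simp add: bounded_clinear_simps[OF E] bounded_clinear_sum[OF E] algebra_simps
          sum.distrib)
    ultimately show ?thesis by blast
  qed
  moreover have "finite F'" using F(1) finite_K by (simp add: F'_def)
  ultimately show ?thesis
    unfolding lower_semi_fredholm_def finite_ccodim_def by blast
qed

text \<open>If \<open>E x = 0\<close>, the parametrix loses its \<open>G\<close> term and each
  \<open>V k x\<close> is in the null space of \<open>B k\<close>. If \<open>y\<close> is a limit of
  values of \<open>E\<close>, it is in every range of \<open>B k\<close>, so the parametrix puts
  \<open>y - R y\<close> in the range of \<open>E\<close>; it remains to cancel
  \<open>1 - R\<close>.\<close>

lemma upper_semi_fredholm:
  assumes usf: "\<And>k. k \<in> K \<Longrightarrow> upper_semi_fredholm (D k) (B k)"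
  shows "upper_semi_fredholm UNIV E"
proof -
  have "\<forall>k\<in>K. \<exists>F. finite F \<and> {x \<in> D k. B k x = 0} \<subseteq> complex_vector.span F"
    using assms by (simp add: upper_semi_fredholm_def finite_cdim_def)
  then obtain F where F: "\<And>k. k \<in> K \<Longrightarrow> finite (F k)"
    "\<And>k. k \<in> K \<Longrightarrow> {x \<in> D k. B k x = 0} \<subseteq> complex_vector.span (F k)"
    by metis
  text \<open>On the null space of \<open>E\<close> the bijection \<open>1 - R\<close>, with inverse \<open>Q\<close>, takes values in a
    finite-dimensional space.\<close>
  obtain Q where Q: "\<And>x. Q x - R (Q x) = x" "\<And>x. Q (x - R x) = x"
    using R_bijective by metis
  \<comment> \<open>Injectivity of \<open>1 - R\<close>: identities for \<open>Q\<close> are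
    verified after applying \<open>1 - R\<close>.\<close>
  have Q_eq: "x = y" if "x - R x = y - R y" for x y
    using Q(2) that by metis
  define F' where "F' = (\<Union>k\<in>K. W k ` F k)"
  have Q_add: "Q (x + y) = Q x + Q y" for x y
  proof (rule Q_eq)
    have "Q (x + y) - R (Q (x + y)) = (Q x - R (Q x)) + (Q y - R (Q y))"
      by (simp only: Q(1))
    then show "Q (x + y) - R (Q (x + y)) = (Q x + Q y) - R (Q x + Q y)"
      by (simp add: bounded_clinear_simps[OF R])
  qed
  have Q_scaleC: "Q (c *\<^sub>C x) = c *\<^sub>C Q x" for c x
  proof (rule Q_eq)
    have "Q (c *\<^sub>C x) - R (Q (c *\<^sub>C x)) = c *\<^sub>C (Q x - R (Q x))"
      by (simp only: Q(1))
    then show "Q (c *\<^sub>C x) - R (Q (c *\<^sub>C x)) = c *\<^sub>C Q x - R (c *\<^sub>C Q x)"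
      by (simp only: bounded_clinear_simps[OF R] scaleC_diff_right)
  qed
  have Q_span: "Q x \<in> complex_vector.span (Q ` F')" if "x \<in> complex_vector.span F'" for x
    using that
  proof (induction rule: complex_vector.span_induct_alt)
    case base
    have "Q 0 = 0" by (rule Q_eq) (simp add: Q bounded_clinear_simps[OF R])
    then show ?case by (simp add: complex_vector.span_zero)
  next
    case (step c x y)
    then show ?case
      by (simp add: Q_add Q_scaleC complex_vector.span_add complex_vector.span_scale
          complex_vector.span_base)
  qed
  have "x \<in> complex_vector.span (Q ` F')" if x: "E x = 0" for x
  proof -
    have "W k (V k x) \<in> complex_vector.span F'" if k: "k \<in> K" for k
    proof -
      have "V k x \<in> complex_vector.span (F k)"
        using F(2)[OF k] V_D[OF k] B_V[OF k] x by auto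
      then have "W k (V k x) \<in> complex_vector.span (W k ` F k)"
        by (rule bounded_clinear_span[OF W[OF k]])
      moreover have "W k ` F k \<subseteq> F'"
        using k by (auto simp: F'_def)
      ultimately show ?thesis
        using complex_vector.span_mono by blast
    qed
    then have "(\<Sum>k\<in>K. W k (V k x)) \<in> complex_vector.span F'"
      by (rule complex_vector.span_sum)
    then have "x - R x \<in> complex_vector.span F'"
      by (simp add: parametrix E_G x bounded_clinear_simps[OF G])
    then show ?thesis using Q_span Q(2) by metis
  qed
  moreover have "finite (Q ` F')" using F(1) finite_K by (simp add: F'_def)
  ultimately have "finite_cdim {x \<in> UNIV. E x = 0}"
    unfolding finite_cdim_def by blast
  moreover have "closed (range E)"
    unfolding closed_sequential_limits
  proof (intro allI impI)
    fix f y assume "(\<forall>n. f n \<in> range E) \<and> f \<longlonglongrightarrow> y"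
    then have "\<forall>n. \<exists>x. f n = E x" and lim: "f \<longlonglongrightarrow> y"
      by blast+
    then obtain x where x: "\<And>n. f n = E (x n)"
      by metis
    \<comment> \<open>The range of \<open>E\<close> is contained in each closed range of
      \<open>B k\<close>, hence so is its limit point \<open>y\<close>.\<close>
    have "y \<in> B k ` D k" if k: "k \<in> K" for k
    proof -
      have "closed (B k ` D k)" using usf[OF k] by (simp add: upper_semi_fredholm_def)
      moreover have "f n \<in> B k ` D k" for n
        using B_V[OF k, of "x n"] V_D[OF k, of "x n"] x by (metis imageI)
      ultimately show ?thesis using lim by (rule closed_sequentially)
    qed
    then have "\<forall>k\<in>K. \<exists>w. w \<in> D k \<and> y = B k w" by blast
    then obtain w where w: "\<And>k. k \<in> K \<Longrightarrow> w k \<in> D k" "\<And>k. k \<in> K \<Longrightarrow> y = B k (w k)"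
      by metis
    have "V k y = E (w k)" if k: "k \<in> K" for k
      using V_B[OF k w(1)[OF k]] w(2)[OF k] by simp
    then have "y - R y = E (G y) + (\<Sum>k\<in>K. W k (E (w k)))"
      unfolding parametrix by (intro arg_cong2[of _ _ _ _ "(+)"] sum.cong) auto
    also have "\<dots> = E (G y + (\<Sum>k\<in>K. W k (w k)))"
      by (simp add: bounded_clinear_simps[OF E] bounded_clinear_sum[OF E] E_W)
    finally have "y - R y = E (G y + (\<Sum>k\<in>K. W k (w k)))" .
    then obtain v where v: "y - R y = E v" by blast
    \<comment> \<open>As \<open>E\<close> commutes with \<open>R\<close>, both
      \<open>E (Q v)\<close> and \<open>y\<close> are sent by \<open>1 - R\<close> to
      \<open>E v\<close>.\<close>
    have "E (Q v) - R (E (Q v)) = E (Q v - R (Q v))"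
      by (simp add: bounded_clinear_simps[OF E] E_R)
    also have "\<dots> = y - R y" by (simp add: Q v)
    finally have "E (Q v) = y" by (rule Q_eq)
    then show "y \<in> range E" by blast
  qed
  ultimately show ?thesis by (simp add: upper_semi_fredholm_def)
qed

end

section \<open>Rescaled semigroups\<close>

definition rescale :: "complex \<Rightarrow> (real \<Rightarrow> 'a::complex_banach \<Rightarrow> 'a) \<Rightarrow> real \<Rightarrow> 'a \<Rightarrow> 'a" where
  "rescale l T s x = exp (- (l * complex_of_real s)) *\<^sub>C T s x"

lemma rescale_rescale_uminus: "rescale (- l) (rescale l T) = T"
  by (intro ext) (simp add: rescale_def exp_add[symmetric])

context C0
begin

lemma C0_rescale: "C0 (rescale l T)"
proof
  have "((\<lambda>t. exp (- (l * complex_of_real t)) *\<^sub>C T t x) \<longlongrightarrow> exp (- (l * complex_of_real 0)) *\<^sub>C x)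
      (at_right 0)" for x
    by (intro tendsto_intros T_tendsto_0)
  moreover have "exp (- (l * complex_of_real (s + t))) *\<^sub>C T (s + t) x =
      exp (- (l * complex_of_real s)) *\<^sub>C T s (exp (- (l * complex_of_real t)) *\<^sub>C T t x)"
    if "s \<ge> 0" "t \<ge> 0" for s t x
    using that by (simp add: T_add T_simps exp_add[symmetric] algebra_simps)
  ultimately show "C0_semigroup (rescale l T)"
    unfolding C0_semigroup_def rescale_def
    by (simp add: T_0 bounded_clinear_scaleC bounded_clinear_T)
qed

text \<open>A product rule: the quotient of the rescaled orbit splits into the quotient of the orbit
  times the exponential, plus the quotient of the exponential times \<open>x\<close>.\<close>

lemma generator_rescale_aux:
  assumes "x \<in> D"
  shows "x \<in> generator_domain (rescale l T) \<and> generator (rescale l T) x = A x - l *\<^sub>C x"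
proof -
  have "((\<lambda>z. exp (- (l * z))) has_field_derivative - l) (at 0)"
    by (auto intro!: derivative_eq_intros)
  then have "((\<lambda>z. (exp (- (l * z)) - 1) / z) \<longlongrightarrow> - l) (at 0)"
    by (simp add: has_field_derivative_iff)
  moreover have "filterlim complex_of_real (at 0) (at_right 0)"
    unfolding filterlim_at
    by (auto intro!: tendsto_eq_intros simp: eventually_at_filter)
  ultimately have *: "((\<lambda>h. (exp (- (l * complex_of_real h)) - 1) / complex_of_real h) \<longlongrightarrow> - l)
      (at_right 0)"
    by (rule filterlim_compose)
  have "((\<lambda>h. exp (- (l * complex_of_real h))) \<longlongrightarrow> exp (- (l * complex_of_real 0))) (at_right 0)"
    by (intro tendsto_intros)
  then have "((\<lambda>h. exp (- (l * complex_of_real h)) *\<^sub>C ((T h x - x) /\<^sub>R h) +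
      ((exp (- (l * complex_of_real h)) - 1) / complex_of_real h) *\<^sub>C x)
      \<longlongrightarrow> exp (- (l * complex_of_real 0)) *\<^sub>C A x + (- l) *\<^sub>C x) (at_right 0)"
    by (intro tendsto_add tendsto_scaleC * tendsto_const generatorD assms)
  moreover have "eventually (\<lambda>h. exp (- (l * complex_of_real h)) *\<^sub>C ((T h x - x) /\<^sub>R h) +
      ((exp (- (l * complex_of_real h)) - 1) / complex_of_real h) *\<^sub>C x
      = (rescale l T h x - x) /\<^sub>R h) (at_right 0)"
    using eventually_at_right_less[of "0::real"]
  proof eventually_elim
    case (elim h)
    have inv: "c *\<^sub>C (y /\<^sub>R h) = (c / complex_of_real h) *\<^sub>C y" for c and y :: 'a
      by (simp add: scaleC_of_real[symmetric] divide_inverse)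
    have "y /\<^sub>R h = (1 / complex_of_real h) *\<^sub>C y" for y :: 'a
      using inv[of 1 y] by simp
    then show ?case
      unfolding inv by (simp add: rescale_def scaleC_diff_right scaleC_diff_left diff_divide_distrib)
  qed
  ultimately have "((\<lambda>h. (rescale l T h x - x) /\<^sub>R h)
      \<longlongrightarrow> exp (- (l * complex_of_real 0)) *\<^sub>C A x + (- l) *\<^sub>C x) (at_right 0)"
    by (rule Lim_transform_eventually)
  from C0.generatorI[OF C0_rescale this] show ?thesis by simp
qed

lemma generator_domain_rescale: "generator_domain (rescale l T) = D"
proof
  show "D \<subseteq> generator_domain (rescale l T)"
    using generator_rescale_aux by blast
  \<comment> \<open>Rescaling once more by \<open>- l\<close> restores \<open>T\<close>, so the
    inclusion just proved also gives this one.\<close>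
  show "generator_domain (rescale l T) \<subseteq> D"
    using C0.generator_rescale_aux[OF C0_rescale, of _ l "- l"] by (auto simp: rescale_rescale_uminus)
qed

lemma generator_rescale: "x \<in> D \<Longrightarrow> generator (rescale l T) x = A x - l *\<^sub>C x"
  using generator_rescale_aux by blast

lemma generator_comp_bounded_rescale:
  assumes "generator_comp_bounded T r" "0 \<le> r"
  shows "generator_comp_bounded (rescale l T) r"
proof -
  have T: "T r x \<in> D" for x
    using assms by (auto simp: generator_comp_bounded_def)
  have "generator (rescale l T) (rescale l T r x) =
      exp (- (l * complex_of_real r)) *\<^sub>C (A (T r x) - l *\<^sub>C T r x)" for x
    using T by (simp add: rescale_def generator_rescale D_scaleC A_scaleC scaleC_diff_right mult.commute)
  then show ?thesis
    using assms T unfolding generator_comp_bounded_def generator_domain_rescale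
    by (auto simp: rescale_def D_scaleC
        intro!: bounded_clinear_scaleC bounded_clinear_sub bounded_clinear_T)
qed

lemma upper_semi_fredholm_generator_rescale:
  "upper_semi_fredholm (generator_domain (rescale l T)) (generator (rescale l T)) \<longleftrightarrow>
   upper_semi_fredholm D (\<lambda>x. A x - l *\<^sub>C x)"
proof -
  have "{x \<in> D. generator (rescale l T) x = 0} = {x \<in> D. A x - l *\<^sub>C x = 0}"
    using generator_rescale by auto
  moreover have "generator (rescale l T) ` D = (\<lambda>x. A x - l *\<^sub>C x) ` D"
    using generator_rescale by (rule image_cong[OF refl])
  ultimately show ?thesis
    by (simp only: upper_semi_fredholm_def generator_domain_rescale)
qed

lemma lower_semi_fredholm_generator_rescale:
  "lower_semi_fredholm (generator_domain (rescale l T)) (generator (rescale l T)) \<longleftrightarrow>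
   lower_semi_fredholm D (\<lambda>x. A x - l *\<^sub>C x)"
proof -
  have "generator (rescale l T) ` D = (\<lambda>x. A x - l *\<^sub>C x) ` D"
    using generator_rescale by (rule image_cong[OF refl])
  then show ?thesis
    by (simp only: lower_semi_fredholm_def generator_domain_rescale)
qed

end

section \<open>Invariance under nonzero scalar factors\<close>

lemma upper_semi_fredholm_scaleC:
  assumes "upper_semi_fredholm D S" "c \<noteq> 0"
  shows "upper_semi_fredholm D (\<lambda>x. c *\<^sub>C S x)"
proof -
  \<comment> \<open>As a preimage under a continuous map, the scaled range inherits
    closedness.\<close>
  have "(\<lambda>x. c *\<^sub>C S x) ` D = (\<lambda>y. inverse c *\<^sub>C y) -` (S ` D)"
  proof (intro equalityI subsetI)
    fix y assume "y \<in> (\<lambda>y. inverse c *\<^sub>C y) -` (S ` D)"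
    then obtain x where "x \<in> D" "inverse c *\<^sub>C y = S x" by blast
    then have "y = c *\<^sub>C S x" using \<open>c \<noteq> 0\<close> by (metis complex_vector.scale_one complex_vector.scale_scale right_inverse)
    then show "y \<in> (\<lambda>x. c *\<^sub>C S x) ` D" using \<open>x \<in> D\<close> by blast
  qed (use assms in auto)
  moreover have "closed ((\<lambda>y. inverse c *\<^sub>C y) -` (S ` D))"
    using assms(1) unfolding upper_semi_fredholm_def
    by (intro closed_vimage linear_continuous_on bounded_linear_scaleC) auto
  ultimately show ?thesis
    using assms by (simp add: upper_semi_fredholm_def)
qed

lemma lower_semi_fredholm_scaleC:
  assumes "lower_semi_fredholm D S" "c \<noteq> 0"
  shows "lower_semi_fredholm D (\<lambda>x. c *\<^sub>C S x)"
proof -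
  obtain F where F: "finite F" "\<And>x. \<exists>b\<in>complex_vector.span F. x - b \<in> S ` D"
    using assms(1) unfolding lower_semi_fredholm_def finite_ccodim_def by blast
  have "\<exists>b\<in>complex_vector.span F. x - b \<in> (\<lambda>x. c *\<^sub>C S x) ` D" for x
  proof -
    obtain b w where b: "b \<in> complex_vector.span F" "w \<in> D" "inverse c *\<^sub>C x - b = S w"
      using F(2)[of "inverse c *\<^sub>C x"] by blast
    have "x - c *\<^sub>C b = c *\<^sub>C S w"
      using assms(2) by (simp add: b(3)[symmetric] scaleC_diff_right)
    then show ?thesis
      using b complex_vector.span_scale[OF b(1), of c] by blast
  qed
  with F(1) show ?thesis
    unfolding lower_semi_fredholm_def finite_ccodim_def by blast
qed

text \<open>Each of the two operators is a nonzero multiple of the other; the two forms serve the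
  two directions of the equivalences below.\<close>

lemma semigroup_minus_eigenvalue:
  "T t x - exp (l * complex_of_real t) *\<^sub>C x = exp (l * complex_of_real t) *\<^sub>C (rescale l T t x - x)"
  "rescale l T t x - x =
    exp (- (l * complex_of_real t)) *\<^sub>C (T t x - exp (l * complex_of_real t) *\<^sub>C x)"
  by (simp_all add: rescale_def scaleC_diff_right exp_add[symmetric])

lemma upper_semi_fredholm_rescale:
  "upper_semi_fredholm UNIV (\<lambda>x. rescale l T t x - x) \<longleftrightarrow>
   upper_semi_fredholm UNIV (\<lambda>x. T t x - exp (l * complex_of_real t) *\<^sub>C x)"
proof
  assume "upper_semi_fredholm UNIV (\<lambda>x. rescale l T t x - x)"
  then show "upper_semi_fredholm UNIV (\<lambda>x. T t x - exp (l * complex_of_real t) *\<^sub>C x)"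
    unfolding semigroup_minus_eigenvalue(1) by (rule upper_semi_fredholm_scaleC) simp
next
  assume "upper_semi_fredholm UNIV (\<lambda>x. T t x - exp (l * complex_of_real t) *\<^sub>C x)"
  then show "upper_semi_fredholm UNIV (\<lambda>x. rescale l T t x - x)"
    unfolding semigroup_minus_eigenvalue(2) by (rule upper_semi_fredholm_scaleC) simp
qed

lemma lower_semi_fredholm_rescale:
  "lower_semi_fredholm UNIV (\<lambda>x. rescale l T t x - x) \<longleftrightarrow>
   lower_semi_fredholm UNIV (\<lambda>x. T t x - exp (l * complex_of_real t) *\<^sub>C x)"
proof
  assume "lower_semi_fredholm UNIV (\<lambda>x. rescale l T t x - x)"
  then show "lower_semi_fredholm UNIV (\<lambda>x. T t x - exp (l * complex_of_real t) *\<^sub>C x)"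
    unfolding semigroup_minus_eigenvalue(1) by (rule lower_semi_fredholm_scaleC) simp
next
  assume "lower_semi_fredholm UNIV (\<lambda>x. T t x - exp (l * complex_of_real t) *\<^sub>C x)"
  then show "lower_semi_fredholm UNIV (\<lambda>x. rescale l T t x - x)"
    unfolding semigroup_minus_eigenvalue(2) by (rule lower_semi_fredholm_scaleC) simp
qed

section \<open>A trigonometric approximate identity\<close>

text \<open>Binomial expansion of the sine written with \<open>z = exp (\<i> x)\<close>. The even
  power leaves only even frequencies, so for \<open>x = pi s / t\<close> the exponents are integer
  multiples of \<open>2 pi \<i> / t\<close>, the differences of solutions of
  \<open>exp (l t) = \<mu>\<close>.\<close>

lemma sin_power_trig_polynomial:
  "complex_of_real (sin x ^ (2 * n)) =
    (\<Sum>j\<le>2 * n. (of_nat (2 * n choose j) * (-1) ^ j / (-4) ^ n) *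
      exp (- (2 * \<i> * (of_nat j - of_nat n) * complex_of_real x)))"
proof -
  define z where "z = exp (\<i> * complex_of_real x)"
  have z0: "z \<noteq> 0" by (simp add: z_def)
  have "complex_of_real (sin x) = (z - inverse z) / (2 * \<i>)"
  proof -
    have "complex_of_real (sin x) = \<i> * (inverse z - z) / 2"
      by (simp add: z_def sin_of_real[symmetric] sin_exp_eq' exp_minus)
    also have "\<i> * (w - v) / 2 = (v - w) / (2 * \<i>)" for v w :: complex
      by (simp add: field_simps)
    finally show ?thesis .
  qed
  then have "complex_of_real (sin x ^ (2 * n)) = (- inverse z + z) ^ (2 * n) / (2 * \<i>) ^ (2 * n)"
    by (simp only: of_real_power power_divide uminus_add_conv_diff)
  also have "(2 * \<i>) ^ (2 * n) = (-4) ^ n"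
    by (simp add: power_mult power_mult_distrib)
  also have "(- inverse z + z) ^ (2 * n) =
      (\<Sum>j\<le>2 * n. of_nat (2 * n choose j) * (- inverse z) ^ j * z ^ (2 * n - j))"
    by (rule binomial_ring)
  also have "\<dots> / (-4) ^ n = (\<Sum>j\<le>2 * n. (of_nat (2 * n choose j) * (-1) ^ j / (-4) ^ n) *
      exp (- (2 * \<i> * (of_nat j - of_nat n) * complex_of_real x)))"
    unfolding sum_divide_distrib
  proof (intro sum.cong refl)
    fix j assume j: "j \<in> {..2 * n}"
    have "(- inverse z) ^ j * z ^ (2 * n - j) = (-1) ^ j * (inverse z ^ j * z ^ (2 * n - j))"
      by (simp add: power_minus[of "inverse z"])
    also have "inverse z ^ j * z ^ (2 * n - j) =
        exp (- (of_nat j * (\<i> * complex_of_real x))) * exp (of_nat (2 * n - j) * (\<i> * complex_of_real x))"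
      by (simp add: z_def exp_of_nat_mult exp_minus power_inverse)
    also have "\<dots> = exp (- (2 * \<i> * (of_nat j - of_nat n) * complex_of_real x))"
      using j by (simp add: exp_add[symmetric] of_nat_diff algebra_simps)
    finally show "of_nat (2 * n choose j) * (- inverse z) ^ j * z ^ (2 * n - j) / (-4) ^ n =
        (of_nat (2 * n choose j) * (-1) ^ j / (-4) ^ n) *
        exp (- (2 * \<i> * (of_nat j - of_nat n) * complex_of_real x))"
      by simp
  qed
  finally show ?thesis .
qed

text \<open>Wallis: integrating the derivative of \<open>sin\<^sup>2\<^sup>n\<^sup>+\<^sup>1 cos\<close> over a period.\<close>

lemma integral_sin_power_cos_le:
  fixes t :: real
  assumes "t > 0"
  shows "real (2 * n + 1) * integral {0..t} (\<lambda>s. sin (pi * s / t) ^ (2 * n) * (cos (pi * s / t))\<^sup>2)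
    \<le> integral {0..t} (\<lambda>s. sin (pi * s / t) ^ (2 * n))"
proof -
  define S where "S s = sin (pi * s / t)" for s
  define C where "C s = cos (pi * s / t)" for s
  have int: "(\<lambda>s. S s ^ m * C s ^ k) integrable_on {0..t}" "(\<lambda>s. S s ^ m) integrable_on {0..t}" for m k
    unfolding S_def C_def using assms by (intro integrable_continuous_interval continuous_intros; simp)+
  have S2: "(S s)\<^sup>2 = 1 - (C s)\<^sup>2" for s by (simp add: S_def C_def sin_squared_eq)
  have "((\<lambda>s. t / pi * (S s ^ (2 * n + 1) * C s)) has_vector_derivative
      (real (2 * n + 1) * (S s ^ (2 * n) * (C s)\<^sup>2) - S s ^ (2 * n + 2))) (at s within {0..t})" for s
    unfolding S_def C_def has_real_derivative_iff_has_vector_derivative[symmetric]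
    by (rule derivative_eq_intros refl | use assms in \<open>simp add: field_simps power2_eq_square\<close>)+
  then have "((\<lambda>s. real (2 * n + 1) * (S s ^ (2 * n) * (C s)\<^sup>2) - S s ^ (2 * n + 2)) has_integral
      t / pi * (S t ^ (2 * n + 1) * C t) - t / pi * (S 0 ^ (2 * n + 1) * C 0)) {0..t}"
    using assms by (intro fundamental_theorem_of_calculus) auto
  \<comment> \<open>The boundary terms vanish because the sine is zero at both endpoints.\<close>
  then have "integral {0..t} (\<lambda>s. real (2 * n + 1) * (S s ^ (2 * n) * (C s)\<^sup>2) - S s ^ (2 * n + 2)) = 0"
    using assms by (simp add: S_def integral_unique)
  then have "real (2 * n + 1) * integral {0..t} (\<lambda>s. S s ^ (2 * n) * (C s)\<^sup>2) =
      integral {0..t} (\<lambda>s. S s ^ (2 * n + 2))"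
    using int by (simp add: integral_diff del: power_Suc)
  also have "\<dots> \<le> integral {0..t} (\<lambda>s. S s ^ (2 * n))"
  proof (intro integral_le int)
    show "S s ^ (2 * n + 2) \<le> S s ^ (2 * n)" for s
      unfolding power_add S2 by (rule mult_left_le) (auto simp: power_mult)
  qed
  finally show ?thesis by (simp add: S_def C_def)
qed

text \<open>On \<open>{0..t}\<close> the cosine vanishes only at \<open>t / 2\<close>. By
  compactness its square has a positive lower bound \<open>m\<close> at distance at least
  \<open>e\<close> from there, and \<open>t / m\<close> times the square then dominates the
  distance.\<close>

lemma abs_le_cos_squared:
  fixes t e :: real
  assumes t: "t > 0" and e: "e > 0"
  shows "\<exists>M\<ge>0. \<forall>s\<in>{0..t}. \<bar>s - t / 2\<bar> \<le> e + M * (cos (pi * s / t))\<^sup>2"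
proof -
  define S where "S = {s \<in> {0..t}. e \<le> \<bar>s - t / 2\<bar>}"
  have "S = {0..t} \<inter> {s. e \<le> \<bar>s - t / 2\<bar>}" by (auto simp: S_def)
  then have comp: "compact S"
    by (auto intro!: compact_Int_closed closed_Collect_le continuous_intros)
  have "\<exists>m>0. \<forall>s\<in>S. m \<le> (cos (pi * s / t))\<^sup>2"
  proof (cases "S = {}")
    case True
    then show ?thesis by (auto intro: exI[of _ 1])
  next
    case False
    have "continuous_on S (\<lambda>s. (cos (pi * s / t))\<^sup>2)"
      using t by (intro continuous_intros) auto
    from continuous_attains_inf[OF comp False this] obtain s0 where s0: "s0 \<in> S"
      "\<And>s. s \<in> S \<Longrightarrow> (cos (pi * s0 / t))\<^sup>2 \<le> (cos (pi * s / t))\<^sup>2" by blast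
    have "cos (pi * s0 / t) \<noteq> 0"
    proof
      assume "cos (pi * s0 / t) = 0"
      then have "cos (pi * s0 / t) = cos (pi / 2)" by simp
      moreover have "0 \<le> pi * s0 / t" "pi * s0 / t \<le> pi"
        using s0(1) t by (auto simp: S_def field_simps)
      ultimately have "pi * s0 / t = pi / 2"
        using cos_inj_pi[of "pi * s0 / t" "pi / 2"] by simp
      then show False using s0(1) t e by (simp add: S_def field_simps)
    qed
    then show ?thesis using s0 by (intro exI[of _ "(cos (pi * s0 / t))\<^sup>2"]) auto
  qed
  then obtain m where m: "m > 0" "\<And>s. s \<in> S \<Longrightarrow> m \<le> (cos (pi * s / t))\<^sup>2" by blast
  have "\<bar>s - t / 2\<bar> \<le> e + t / m * (cos (pi * s / t))\<^sup>2" if s: "s \<in> {0..t}" for s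
  proof (cases "s \<in> S")
    case True
    have "\<bar>s - t / 2\<bar> \<le> t" using s by (auto simp: abs_if)
    also have "\<dots> \<le> t / m * (cos (pi * s / t))\<^sup>2"
      using mult_left_mono[OF m(2)[OF True], of "t / m"] t m(1) by simp
    finally show ?thesis using e by simp
  next
    case False
    have "0 \<le> t / m * (cos (pi * s / t))\<^sup>2" using t m by simp
    then show ?thesis using False s by (simp add: S_def)
  qed
  then show ?thesis using t m by (intro exI[of _ "t / m"]) auto
qed

text \<open>The kernel is the normalized power \<open>sin (pi s / t) ^ (2 * n)\<close>, peaked at
  \<open>t / 2\<close>. The Wallis estimate makes the mean of the squared cosine at most
  \<open>1 / (2 n + 1)\<close>, so the mean distance to \<open>t / 2\<close> is at most
  \<open>e / 2 + M / (2 n + 1)\<close>.\<close>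

lemma trigonometric_kernel:
  fixes t e :: real
  assumes t: "t > 0" and e: "e > 0"
  shows "\<exists>n (c :: nat \<Rightarrow> complex) p. continuous_on {0..t} p \<and> (\<forall>s. 0 \<le> p s) \<and>
    integral {0..t} p = 1 \<and> integral {0..t} (\<lambda>s. p s * \<bar>s - t / 2\<bar>) \<le> e \<and>
    (\<forall>s. complex_of_real (p s) =
      (\<Sum>j\<le>2 * n. c j * exp (- (2 * of_real pi * \<i> * (of_nat j - of_nat n) / of_real t * of_real s))))"
proof -
  obtain M where M: "M \<ge> 0" "\<And>s. s \<in> {0..t} \<Longrightarrow> \<bar>s - t / 2\<bar> \<le> e / 2 + M * (cos (pi * s / t))\<^sup>2"
    using abs_le_cos_squared[OF t, of "e / 2"] e by auto
  \<comment> \<open>This size of \<open>n\<close> makes \<open>M / (2 n + 1)\<close> at most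
    \<open>e / 2\<close>.\<close>
  obtain n :: nat where n: "2 * M / e \<le> real n" using real_arch_simple by blast
  define S where "S s = sin (pi * s / t)" for s
  define I where "I = integral {0..t} (\<lambda>s. S s ^ (2 * n))"
  have cont: "continuous_on {0..t} (\<lambda>s. S s ^ (2 * n))"
    unfolding S_def using t by (intro continuous_intros) auto
  have contS: "continuous_on {0..t} S"
    unfolding S_def using t by (intro continuous_intros) auto
  have S0: "0 \<le> S s ^ (2 * n)" for s by (simp add: power_mult)
  \<comment> \<open>A nonnegative continuous integrand with zero integral vanishes, but
    \<open>S (t / 2) = 1\<close>.\<close>
  have "I \<noteq> 0"
  proof
    assume "I = 0"
    then have "((\<lambda>s. S s ^ (2 * n)) has_integral 0) (cbox 0 t)"
      using integrable_integral[OF integrable_continuous_interval[OF cont]] by (simp add: I_def)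
    then have "S (t / 2) ^ (2 * n) = 0"
      using t cont S0 by (intro has_integral_0_cbox_imp_0[of 0 t "\<lambda>s. S s ^ (2 * n)"]) auto
    then show False using t by (simp add: S_def)
  qed
  moreover have "I \<ge> 0"
    unfolding I_def by (intro integral_nonneg integrable_continuous_interval cont S0)
  ultimately have I: "I > 0" by simp
  define p where "p s = S s ^ (2 * n) / I" for s
  have int: "(\<lambda>s. S s ^ (2 * n) * f s) integrable_on {0..t}" if "continuous_on {0..t} f" for f
    by (intro integrable_continuous_interval continuous_on_mult cont that)
  define J where "J = integral {0..t} (\<lambda>s. S s ^ (2 * n) * (cos (pi * s / t))\<^sup>2)"
  have "integral {0..t} (\<lambda>s. S s ^ (2 * n) * \<bar>s - t / 2\<bar>) \<le>
      integral {0..t} (\<lambda>s. S s ^ (2 * n) * (e / 2) + M * (S s ^ (2 * n) * (cos (pi * s / t))\<^sup>2))"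
  proof (intro integral_le integrable_continuous_interval)
    show "S s ^ (2 * n) * \<bar>s - t / 2\<bar> \<le>
        S s ^ (2 * n) * (e / 2) + M * (S s ^ (2 * n) * (cos (pi * s / t))\<^sup>2)" if "s \<in> {0..t}" for s
      using mult_left_mono[OF M(2)[OF that] S0[of s]] by (simp add: algebra_simps)
  qed (use t in \<open>auto intro!: continuous_intros contS\<close>)
  also have "\<dots> = I * (e / 2) + M * J"
    unfolding I_def J_def using t
    by (subst integral_add) (auto intro!: integrable_continuous_interval continuous_intros contS)
  also have "M * J \<le> I * (e / 2)"
  proof -
    have J: "real (2 * n + 1) * J \<le> I"
      using integral_sin_power_cos_le[OF t, of n] by (simp add: I_def J_def S_def)
    have "J \<ge> 0"
      unfolding J_def using t S0
      by (intro integral_nonneg int continuous_intros) auto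
    have "2 * M \<le> e * real (2 * n + 1)"
    proof -
      have "2 * M \<le> e * real n" using n e by (simp add: field_simps)
      also have "\<dots> \<le> e * real (2 * n + 1)" using e by (intro mult_left_mono) auto
      finally show ?thesis .
    qed
    then have "2 * M * J \<le> e * real (2 * n + 1) * J"
      using \<open>J \<ge> 0\<close> by (rule mult_right_mono)
    also have "\<dots> \<le> e * I" using mult_left_mono[OF J, of e] e by (simp add: mult.assoc)
    finally show ?thesis by (simp add: algebra_simps)
  qed
  finally have *: "integral {0..t} (\<lambda>s. S s ^ (2 * n) * \<bar>s - t / 2\<bar>) \<le> I * e" by simp
  define c :: "nat \<Rightarrow> complex" where
    "c j = of_nat (2 * n choose j) * (-1) ^ j / (-4) ^ n / complex_of_real I" for j
  have "continuous_on {0..t} p"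
    unfolding p_def using I by (intro continuous_intros cont) auto
  moreover have "\<forall>s. 0 \<le> p s" using I S0 by (simp add: p_def)
  moreover have "integral {0..t} p = 1"
    using I unfolding p_def by (simp add: I_def[symmetric])
  moreover have "integral {0..t} (\<lambda>s. p s * \<bar>s - t / 2\<bar>) \<le> e"
    using * I unfolding p_def by (simp add: field_simps)
  moreover have "complex_of_real (p s) = (\<Sum>j\<le>2 * n. c j *
      exp (- (2 * of_real pi * \<i> * (of_nat j - of_nat n) / of_real t * of_real s)))" for s
    unfolding p_def S_def of_real_divide sin_power_trig_polynomial sum_divide_distrib
    by (intro sum.cong refl) (simp add: c_def mult_ac)
  ultimately show ?thesis by blast
qed

section \<open>From the generator to the semigroup\<close>

context C0
begin

text \<open>Eventual norm continuity: past \<open>r0\<close> every vector \<open>y = T r x\<close>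
  has \<open>A y\<close> bounded by a multiple of the norm of \<open>x\<close>, and increments of
  its orbit are integrals of the orbit of \<open>A y\<close>.\<close>

lemma Lipschitz_beyond:
  assumes bd: "generator_comp_bounded T r0" and r: "0 \<le> r0" "r0 \<le> r"
  shows "\<exists>L>0. \<forall>s\<in>{0..t}. \<forall>s'\<in>{0..t}. \<forall>x. norm (T (r + s) x - T (r + s') x) \<le> L * \<bar>s - s'\<bar> * norm x"
proof -
  have T_D: "T r0 x \<in> D" for x
    using bd by (auto simp: generator_comp_bounded_def)
  have lin: "bounded_clinear (\<lambda>x. A (T r0 x))"
    using bd by (simp add: generator_comp_bounded_def)
  obtain K where K: "K > 0" "\<And>x. norm (A (T r0 x)) \<le> norm x * K"
    using bounded_linear.pos_bounded[OF bounded_clinear_bounded_linear[OF lin]] by blast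
  obtain M where M: "M \<ge> 1" "\<And>s x. s \<in> {0..t + r} \<Longrightarrow> norm (T s x) \<le> M * norm x"
    using locally_bounded by blast
  \<comment> \<open>The three factors \<open>M\<close> bound \<open>T (r - r0)\<close>, the
    integrand of \<open>V (s - s')\<close>, and \<open>T s'\<close>.\<close>
  define L where "L = M * M * M * K"
  have *: "norm (T (r + s) x - T (r + s') x) \<le> L * \<bar>s - s'\<bar> * norm x"
    if s: "0 \<le> s'" "s' \<le> s" "s \<le> t" for s s' x
  proof -
    define y where "y = T r x"
    have y: "y = T r0 (T (r - r0) x)"
      using T_add[of r0 "r - r0" x] r by (simp add: y_def)
    have yD: "y \<in> D" unfolding y by (rule T_D)
    have "norm (A y) \<le> norm (T (r - r0) x) * K"
      unfolding y by (rule K)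
    also have "\<dots> \<le> (M * norm x) * K"
      using M(2)[of "r - r0" x] K(1) r s by (intro mult_right_mono) auto
    finally have Ay: "norm (A y) \<le> M * norm x * K" .
    have "T (r + s) x - T (r + s') x = T s y - T s' y"
      using r s by (simp add: y_def T_add[symmetric] add.commute)
    also have "\<dots> = T s' (T (s - s') y - y)"
      using T_add[of s' "s - s'" y] s by (simp add: T_simps)
    also have "T (s - s') y - y = V (s - s') (A y)"
      using V_A[OF yD, of "s - s'"] s by simp
    finally have "norm (T (r + s) x - T (r + s') x) \<le> M * norm (V (s - s') (A y))"
      using M(2)[of s'] s r by simp
    also have "norm (V (s - s') (A y)) \<le> M * norm (A y) * (s - s')"
      unfolding orbit_integral_def
      using integrable_bound[of "M * norm (A y)" "\<lambda>s. T s (A y)" 0 "s - s'"] M r s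
        integrable_orbit[of 0 "A y" "s - s'"]
      by simp
    also have "M * (M * norm (A y) * (s - s')) \<le> M * (M * (M * norm x * K) * (s - s'))"
      using M(1) s Ay by (intro mult_left_mono mult_right_mono) auto
    finally show ?thesis
      using M(1) s by (simp add: L_def mult_ac)
  qed
  have "norm (T (r + s) x - T (r + s') x) \<le> L * \<bar>s - s'\<bar> * norm x"
    if "s \<in> {0..t}" "s' \<in> {0..t}" for s s' x
    using *[of s' s x] *[of s s' x] that
    by (cases "s' \<le> s") (auto simp: norm_minus_commute abs_minus_commute)
  moreover have "L > 0" using M(1) K(1) by (simp add: L_def)
  ultimately show ?thesis by blast
qed

text \<open>This geometric sum supplies \<open>G\<close>: it exhibits \<open>T (n t) - 1\<close> as
  a multiple of \<open>T t - 1\<close>.\<close>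

lemma T_telescope:
  assumes "t \<ge> 0"
  shows "(\<Sum>j<n. T (real j * t) (T t x - x)) = T (real n * t) x - x"
proof (induction n)
  case (Suc n)
  have "T (real (Suc n) * t) x = T (real n * t) (T t x)"
    using T_add[of "real n * t" t x] assms by (simp add: algebra_simps)
  then show ?case using Suc assms by (simp add: T_simps)
qed (simp add: T_0)

text \<open>At time \<open>t\<close> the exponent is an integer multiple of
  \<open>2 pi \<i>\<close>. All these rescalings therefore share the operator
  \<open>T t - 1\<close>, as one factorization requires.\<close>

lemma rescale_period:
  assumes "t \<noteq> 0"
  shows "rescale (2 * of_real pi * \<i> * (of_nat j - of_nat n) / of_real t) T t = T t"
proof -
  have "exp (- (2 * of_real pi * \<i> * (of_nat j - of_nat n))) = 1"
    using exp_integer_2pi[of "of_int (int n - int j)"] by (simp add: algebra_simps)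
  then show ?thesis using assms by (intro ext) (simp add: rescale_def)
qed

text \<open>With the kernel \<open>p\<close> concentrated at \<open>t / 2\<close> and \<open>r + t / 2 = N t\<close>, norm continuity beyond
  \<open>r0\<close> makes \<open>R = T (N t) - T r \<integral>\<^sub>0\<^sup>t p s T s ds\<close> small, and the integral is a
  combination of the operators \<open>\<integral>\<^sub>0\<^sup>t exp (- l s) T s ds\<close>, which factor \<open>T t - 1\<close> through
  \<open>A - l\<close>.\<close>

lemma factorization_exists:
  assumes bd: "generator_comp_bounded T r0" and r0: "0 \<le> r0" and t: "t > 0"
  shows "\<exists>(n::nat) R G W. factorization (\<lambda>x. T t x - x) R G {..2 * n}
    (\<lambda>j. generator_domain (rescale (2 * of_real pi * \<i> * (of_nat j - of_nat n) / of_real t) T))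
    (\<lambda>j. generator (rescale (2 * of_real pi * \<i> * (of_nat j - of_nat n) / of_real t) T))
    (\<lambda>j. orbit_integral (rescale (2 * of_real pi * \<i> * (of_nat j - of_nat n) / of_real t) T) t)
    W (1 / 2)"
proof -
  obtain m :: nat where m: "r0 / t \<le> real m" using real_arch_simple by blast
  \<comment> \<open>The multiple of \<open>t\<close> passes \<open>r0\<close>; the extra
    \<open>t / 2\<close> makes \<open>r + t / 2\<close> equal to \<open>(m + 1) t\<close>.\<close>
  define r where "r = real m * t + t / 2"
  have r: "r0 \<le> r" "0 \<le> r" using m t r0 by (auto simp: r_def field_simps)
  obtain L where L: "L > 0" "\<And>s s' x. s \<in> {0..t} \<Longrightarrow> s' \<in> {0..t} \<Longrightarrow>
      norm (T (r + s) x - T (r + s') x) \<le> L * \<bar>s - s'\<bar> * norm x"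
    using Lipschitz_beyond[OF bd r0 r(1)] by blast
  \<comment> \<open>The moment bound \<open>1 / (2 L)\<close> is matched to the Lipschitz constant,
    so that \<open>R\<close> has norm at most \<open>1 / 2\<close>.\<close>
  obtain n c p where p: "continuous_on {0..t} p" "\<And>s. 0 \<le> p s" "integral {0..t} p = 1"
      "integral {0..t} (\<lambda>s. p s * \<bar>s - t / 2\<bar>) \<le> 1 / (2 * L)"
    and p_sum: "\<And>s. complex_of_real (p s) =
      (\<Sum>j\<le>2 * n. c j * exp (- (2 * of_real pi * \<i> * (of_nat j - of_nat n) / of_real t * of_real s)))"
    using trigonometric_kernel[OF t, of "1 / (2 * L)"] L(1) by fastforce
  define l :: "nat \<Rightarrow> complex" where "l j = 2 * of_real pi * \<i> * (of_nat j - of_nat n) / of_real t" for j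
  interpret rescaled: C0 "rescale (l j) T" for j by (rule C0_rescale)
  define N where "N = Suc m"
  define Q where "Q x = (\<Sum>j\<le>2 * n. c j *\<^sub>C orbit_integral (rescale (l j) T) t x)" for x
  define R where "R x = T (real N * t) x - T r (Q x)" for x
  \<comment> \<open>The sign is negative because telescoping gives \<open>T (N t) x - x\<close>,
    while the parametrix needs \<open>x - T (N t) x\<close>.\<close>
  define G where "G x = - (\<Sum>j<N. T (real j * t) x)" for x
  define W where "W j x = c j *\<^sub>C T r x" for j x
  have V_T': "orbit_integral (rescale (l j) T) t (T s x) = T s (orbit_integral (rescale (l j) T) t x)"
    if s: "s \<ge> 0" for j s x
  proof -
    \<comment> \<open>\<open>T s\<close> is a scalar multiple of the rescaled operator, which
      commutes with its own orbit integral.\<close>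
    have "T s = (\<lambda>x. exp (l j * complex_of_real s) *\<^sub>C rescale (l j) T s x)"
      by (intro ext) (simp add: rescale_def exp_add[symmetric])
    then show ?thesis
      using rescaled.V_T[OF s, of j t x] by (simp add: rescaled.V_simps)
  qed
  have rescale_t: "rescale (l j) T t = T t" for j
    unfolding l_def using t by (intro rescale_period) simp
  \<comment> \<open>Each exponential of the kernel is absorbed by a rescaling, which identifies
    \<open>Q x\<close> with the \<open>p\<close>-weighted average of the orbit.\<close>
  have Q_integral: "((\<lambda>s. p s *\<^sub>R T s x) has_integral Q x) {0..t}" for x
  proof -
    have "((\<lambda>s. \<Sum>j\<le>2 * n. c j *\<^sub>C rescale (l j) T s x) has_integral Q x) {0..t}"
      unfolding Q_def
    proof (intro has_integral_sum)
      fix j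
      have "((\<lambda>s. rescale (l j) T s x) has_integral orbit_integral (rescale (l j) T) t x) {0..t}"
        unfolding orbit_integral_def by (intro integrable_integral rescaled.integrable_orbit) simp
      from has_integral_linear[OF this bounded_linear_scaleC]
      show "((\<lambda>s. c j *\<^sub>C rescale (l j) T s x) has_integral
          c j *\<^sub>C orbit_integral (rescale (l j) T) t x) {0..t}"
        by (simp add: o_def)
    qed simp
    moreover have "(\<Sum>j\<le>2 * n. c j *\<^sub>C rescale (l j) T s x) = p s *\<^sub>R T s x" for s
      unfolding scaleC_of_real[symmetric] p_sum l_def
      by (simp add: rescale_def complex_vector.scale_sum_left)
    ultimately show ?thesis by simp
  qed
  have R_bound: "norm (R x) \<le> 1 / 2 * norm x" for x
  proof -
    have rN: "r + t / 2 = real N * t" by (simp add: r_def N_def algebra_simps)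
    have 1: "((\<lambda>s. T r (p s *\<^sub>R T s x)) has_integral T r (Q x)) {0..t}"
      using has_integral_linear[OF Q_integral[of x]
          bounded_clinear_bounded_linear[OF bounded_clinear_T[OF r(2)]]]
      by (simp add: o_def)
    \<comment> \<open>Because \<open>p\<close> has integral 1, \<open>T (N t) x\<close> is also a
      \<open>p\<close>-weighted average, and \<open>R x\<close> becomes the average of
      \<open>T (r + t / 2) x - T (r + s) x\<close>.\<close>
    have 2: "((\<lambda>s. p s *\<^sub>R T (real N * t) x) has_integral 1 *\<^sub>R T (real N * t) x) {0..t}"
      using integrable_integral[OF integrable_continuous_interval[OF p(1)]] p(3)
      by (intro has_integral_scaleR_left) simp
    from has_integral_diff[OF 2 1]
    have "((\<lambda>s. p s *\<^sub>R T (real N * t) x - T r (p s *\<^sub>R T s x)) has_integral R x) {0..t}"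
      by (simp add: R_def)
    then have int: "(\<lambda>s. p s *\<^sub>R T (real N * t) x - T r (p s *\<^sub>R T s x)) integrable_on {0..t}"
      and R_eq: "R x = integral {0..t} (\<lambda>s. p s *\<^sub>R T (real N * t) x - T r (p s *\<^sub>R T s x))"
      by (auto simp: has_integral_iff)
    have int2: "(\<lambda>s. p s * \<bar>s - t / 2\<bar>) integrable_on {0..t}"
      by (intro integrable_continuous_interval continuous_intros p)
    have "norm (R x) \<le> integral {0..t} (\<lambda>s. (L * norm x) * (p s * \<bar>s - t / 2\<bar>))"
      unfolding R_eq
    proof (intro integral_norm_bound_integral int integrable_on_mult_right int2)
      fix s assume s: "s \<in> {0..t}"
      have "p s *\<^sub>R T (real N * t) x - T r (p s *\<^sub>R T s x) = p s *\<^sub>R (T (r + t / 2) x - T (r + s) x)"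
        using s r by (simp add: rN T_simps T_add scaleR_diff_right)
      then have "norm (p s *\<^sub>R T (real N * t) x - T r (p s *\<^sub>R T s x)) =
          p s * norm (T (r + t / 2) x - T (r + s) x)"
        using p(2) by simp
      also have "\<dots> \<le> p s * (L * \<bar>t / 2 - s\<bar> * norm x)"
        using L(2)[of "t / 2" s x] s t p(2) by (intro mult_left_mono) auto
      finally show "norm (p s *\<^sub>R T (real N * t) x - T r (p s *\<^sub>R T s x)) \<le>
          (L * norm x) * (p s * \<bar>s - t / 2\<bar>)"
        by (simp add: mult_ac abs_minus_commute)
    qed
    also have "\<dots> = (L * norm x) * integral {0..t} (\<lambda>s. p s * \<bar>s - t / 2\<bar>)"
      by simp
    also have "\<dots> \<le> (L * norm x) * (1 / (2 * L))"
      using L(1) by (intro mult_left_mono p) simp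
    finally show ?thesis using L(1) by simp
  qed
  have E: "bounded_clinear (\<lambda>x. T t x - x)"
    using t by (intro bounded_clinear_sub bounded_clinear_T bounded_clinear_ident) simp
  have Q: "bounded_clinear Q"
    unfolding Q_def
    by (intro bounded_clinear_sum_fun bounded_clinear_scaleC rescaled.bounded_clinear_V)
  have Q_T: "Q (T s x) = T s (Q x)" if "s \<ge> 0" for s x
    using that by (simp add: Q_def V_T' bounded_clinear_sum[OF bounded_clinear_T] T_simps)
  have G: "bounded_clinear (\<lambda>x. \<Sum>j<N. T (real j * t) x)"
    using t by (intro bounded_clinear_sum_fun bounded_clinear_T) simp
  have "factorization (\<lambda>x. T t x - x) R G {..2 * n}
    (\<lambda>j. generator_domain (rescale (l j) T)) (\<lambda>j. generator (rescale (l j) T))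
    (\<lambda>j. orbit_integral (rescale (l j) T) t) W (1 / 2)"
  proof
    show "bounded_clinear R"
      unfolding R_def using t r
      by (intro bounded_clinear_sub bounded_clinear_T bounded_clinear_compose[OF bounded_clinear_T Q]) auto
    show "bounded_clinear G"
      unfolding G_def using bounded_clinear_sub[OF bounded_clinear_zero G] by simp
    show "bounded_clinear (W j)" for j
      unfolding W_def using r by (intro bounded_clinear_scaleC bounded_clinear_T)
    show "bounded_clinear (orbit_integral (rescale (l j) T) t)" for j
      by (rule rescaled.bounded_clinear_V)
    show "orbit_integral (rescale (l j) T) t x \<in> generator_domain (rescale (l j) T)" for j x
      using t by (intro rescaled.V_in_D) simp
    show "generator (rescale (l j) T) (orbit_integral (rescale (l j) T) t x) = T t x - x" for j x
      using t by (simp add: rescaled.A_V rescale_t)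
    show "orbit_integral (rescale (l j) T) t (generator (rescale (l j) T) x) = T t x - x"
      if "x \<in> generator_domain (rescale (l j) T)" for j x
      using t that by (simp add: rescaled.V_A rescale_t)
    show "T t (W j x) - W j x = W j (T t x - x)" for j x
      using t r by (simp add: W_def T_simps T_commute[of t r] scaleC_diff_right)
    show "T t (R x) - R x = R (T t x - x)" for x
      using t r by (simp add: R_def T_simps bounded_clinear_simps[OF Q] Q_T T_commute[of t r]
          T_commute[of t "real N * t"])
    show "T t (G x) - G x = G (T t x - x)" for x
      using t by (simp add: G_def T_simps bounded_clinear_sum[OF bounded_clinear_T]
          T_commute[of t "real _ * t"] sum_subtractf)
    show "x - R x = T t (G x) - G x + (\<Sum>j\<le>2 * n. W j (orbit_integral (rescale (l j) T) t x))" for x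
    proof -
      have "T t (G x) - G x = - (\<Sum>j<N. T (real j * t) (T t x - x))"
        using t by (simp add: G_def T_simps bounded_clinear_sum[OF bounded_clinear_T]
            T_commute[of t "real _ * t"] sum_subtractf)
      also have "\<dots> = x - T (real N * t) x"
        using t by (subst T_telescope) auto
      finally have "T t (G x) - G x = x - T (real N * t) x" .
      moreover have "(\<Sum>j\<le>2 * n. W j (orbit_integral (rescale (l j) T) t x)) = T r (Q x)"
        using r by (simp add: W_def Q_def bounded_clinear_sum[OF bounded_clinear_T] T_simps)
      ultimately show ?thesis by (simp add: R_def)
    qed
  qed (use R_bound E in auto)
  then show ?thesis unfolding l_def by blast
qed

end

section \<open>The spectral mapping theorem\<close>

lemma
  assumes T: "C0_semigroup T" and bd: "generator_comp_bounded T r" and r: "0 \<le> r" and t: "t > 0"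
  shows upper_semi_fredholm_semigroup_iff:
      "upper_semi_fredholm UNIV (\<lambda>x. T t x - exp (l * complex_of_real t) *\<^sub>C x) \<longleftrightarrow>
       (\<forall>l'. exp (l' * complex_of_real t) = exp (l * complex_of_real t) \<longrightarrow>
          upper_semi_fredholm (generator_domain T) (\<lambda>x. generator T x - l' *\<^sub>C x))"
    and lower_semi_fredholm_semigroup_iff:
      "lower_semi_fredholm UNIV (\<lambda>x. T t x - exp (l * complex_of_real t) *\<^sub>C x) \<longleftrightarrow>
       (\<forall>l'. exp (l' * complex_of_real t) = exp (l * complex_of_real t) \<longrightarrow>
          lower_semi_fredholm (generator_domain T) (\<lambda>x. generator T x - l' *\<^sub>C x))"
proof -
  interpret C0 T by standard (rule T)
  interpret rescaled: C0 "rescale l' T" for l' by (rule C0_rescale)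
  note bd' = generator_comp_bounded_rescale[OF bd r]
  \<comment> \<open>Rescaling by \<open>l'\<close> moves the point \<open>exp (l' t)\<close> to 1,
    up to a nonzero scalar factor, so the results for \<open>T t - 1\<close> and \<open>A\<close>
    apply to the rescaled semigroup.\<close>
  have "upper_semi_fredholm D (\<lambda>x. A x - l' *\<^sub>C x)"
    if "upper_semi_fredholm UNIV (\<lambda>x. T t x - exp (l' * complex_of_real t) *\<^sub>C x)" for l'
    using rescaled.upper_semi_fredholm_generator[of l' r t] bd'[of l'] r t that
    by (simp add: upper_semi_fredholm_rescale upper_semi_fredholm_generator_rescale
        generator_comp_bounded_def)
  moreover have "lower_semi_fredholm D (\<lambda>x. A x - l' *\<^sub>C x)"
    if "lower_semi_fredholm UNIV (\<lambda>x. T t x - exp (l' * complex_of_real t) *\<^sub>C x)" for l'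
    using rescaled.lower_semi_fredholm_generator[of t l'] t that
    by (simp add: lower_semi_fredholm_rescale lower_semi_fredholm_generator_rescale)
  moreover obtain n R G W where fact: "factorization (\<lambda>x. rescale l T t x - x) R G {..2 * n}
    (\<lambda>j. generator_domain (rescale (2 * of_real pi * \<i> * (of_nat j - of_nat n) / of_real t) (rescale l T)))
    (\<lambda>j. generator (rescale (2 * of_real pi * \<i> * (of_nat j - of_nat n) / of_real t) (rescale l T)))
    (\<lambda>j. orbit_integral (rescale (2 * of_real pi * \<i> * (of_nat j - of_nat n) / of_real t) (rescale l T)) t)
    W (1 / 2)"
    using rescaled.factorization_exists[OF bd' r t] by blast
  \<comment> \<open>These finitely many indices all have the same exponential at time
    \<open>t\<close>, so the assumption on every such \<open>l'\<close> covers the whole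
    factorization.\<close>
  define l' :: "nat \<Rightarrow> complex" where
    "l' j = l + 2 * of_real pi * \<i> * (of_nat j - of_nat n) / of_real t" for j
  have rr: "rescale (2 * of_real pi * \<i> * (of_nat j - of_nat n) / of_real t) (rescale l T) =
      rescale (l' j) T" for j
    by (intro ext) (simp add: rescale_def l'_def exp_add[symmetric] algebra_simps)
  have exp_l': "exp (l' j * complex_of_real t) = exp (l * complex_of_real t)" for j
  proof -
    have "l' j * complex_of_real t = l * complex_of_real t + 2 * of_real pi * \<i> * of_int (int j - int n)"
      using t by (simp add: l'_def field_simps)
    then show ?thesis
      using exp_integer_2pi[of "of_int (int j - int n)"] by (simp add: exp_add mult_ac)
  qed
  note factorization.upper_semi_fredholm[OF fact, unfolded rr upper_semi_fredholm_rescale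
      upper_semi_fredholm_generator_rescale]
    factorization.lower_semi_fredholm[OF fact, unfolded rr lower_semi_fredholm_rescale
      lower_semi_fredholm_generator_rescale]
  ultimately show
    "upper_semi_fredholm UNIV (\<lambda>x. T t x - exp (l * complex_of_real t) *\<^sub>C x) \<longleftrightarrow>
       (\<forall>l'. exp (l' * complex_of_real t) = exp (l * complex_of_real t) \<longrightarrow>
          upper_semi_fredholm (generator_domain T) (\<lambda>x. generator T x - l' *\<^sub>C x))"
    "lower_semi_fredholm UNIV (\<lambda>x. T t x - exp (l * complex_of_real t) *\<^sub>C x) \<longleftrightarrow>
       (\<forall>l'. exp (l' * complex_of_real t) = exp (l * complex_of_real t) \<longrightarrow>
          lower_semi_fredholm (generator_domain T) (\<lambda>x. generator T x - l' *\<^sub>C x))"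
    using exp_l' by metis+
qed

text \<open>Negating the equivalence gives both inclusions at once for any such pair of properties;
  \<open>Ln \<mu> / t\<close> provides a preimage of each nonzero \<open>\<mu>\<close>.\<close>

lemma spectral_mapping:
  assumes t: "t > 0"
    and iff: "\<And>l. P (exp (l * complex_of_real t)) \<longleftrightarrow>
      (\<forall>l'. exp (l' * complex_of_real t) = exp (l * complex_of_real t) \<longrightarrow> P' l')"
  shows "{\<mu>. \<not> P \<mu>} - {0} = {exp (\<mu> * complex_of_real t) | \<mu>. \<mu> \<in> {\<mu>. \<not> P' \<mu>}}"
proof (intro equalityI subsetI)
  fix \<mu> assume \<mu>: "\<mu> \<in> {\<mu>. \<not> P \<mu>} - {0}"
  then have l: "exp (Ln \<mu> / complex_of_real t * complex_of_real t) = \<mu>"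
    using t by simp
  then obtain l' where "exp (l' * complex_of_real t) = \<mu>" "\<not> P' l'"
    using iff[of "Ln \<mu> / complex_of_real t"] \<mu> by auto
  then show "\<mu> \<in> {exp (\<mu> * complex_of_real t) | \<mu>. \<mu> \<in> {\<mu>. \<not> P' \<mu>}}" by blast
qed (use iff in auto)

theorem theorem1:
  fixes T :: "real \<Rightarrow> 'a::complex_banach \<Rightarrow> 'a"
  assumes "C0_semigroup T"
    and "\<exists>t0>0. generator_comp_bounded T t0"
  shows "(\<forall>t>0. spectrum_uf UNIV (T t) - {0} =
            {exp (\<mu> * complex_of_real t) | \<mu>. \<mu> \<in> spectrum_uf (generator_domain T) (generator T)}) \<and>
         (reflexive_space TYPE('a) \<longrightarrow>
           (\<forall>t>0. spectrum_lf UNIV (T t) - {0} =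
              {exp (\<mu> * complex_of_real t) | \<mu>. \<mu> \<in> spectrum_lf (generator_domain T) (generator T)} \<and>
            spectrum_e UNIV (T t) - {0} =
              {exp (\<mu> * complex_of_real t) | \<mu>. \<mu> \<in> spectrum_e (generator_domain T) (generator T)}))"
proof -
  obtain r where r: "0 \<le> r" "generator_comp_bounded T r"
    using assms(2) less_imp_le by blast
  note iffs = upper_semi_fredholm_semigroup_iff[OF assms(1) r(2,1)]
    lower_semi_fredholm_semigroup_iff[OF assms(1) r(2,1)]
  have "spectrum_uf UNIV (T t) - {0} =
            {exp (\<mu> * complex_of_real t) | \<mu>. \<mu> \<in> spectrum_uf (generator_domain T) (generator T)}"
    if "t > 0" for t
    unfolding spectrum_uf_def by (rule spectral_mapping[OF that iffs(1)[OF that]])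
  moreover have "spectrum_lf UNIV (T t) - {0} =
            {exp (\<mu> * complex_of_real t) | \<mu>. \<mu> \<in> spectrum_lf (generator_domain T) (generator T)}"
    if "t > 0" for t
    unfolding spectrum_lf_def by (rule spectral_mapping[OF that iffs(2)[OF that]])
  \<comment> \<open>Being Fredholm is a conjunction, and the universal quantifier over
    \<open>l'\<close> distributes over it, so the two equivalences combine.\<close>
  moreover have "spectrum_e UNIV (T t) - {0} =
            {exp (\<mu> * complex_of_real t) | \<mu>. \<mu> \<in> spectrum_e (generator_domain T) (generator T)}"
    if "t > 0" for t
    unfolding spectrum_e_def fredholm_def
    by (rule spectral_mapping[OF that]) (use iffs[OF that] in blast)
  ultimately show ?thesis by blast
qed

end
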